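(* Let $k\ge 1$ and let $E\subset\mathbb R^2$ be a compact set. For $x_1\in E$ let $$(A_\Delta)^{TC_k^{vtx}}_{x_1}(E)=\Big\{\big(\mathrm{Area}(x_{2i-1},x_{2i},x_{2i+1})\big)_{i=1}^{k}: x_2,x_3,\dots,x_{2k+1}\in E\text{ distinct}\Big\}\subset\mathbb R^k.$$ If $\dim(E)>1$, then there exists $x_1\in E$ such that $\mathcal L^k\big((A_\Delta)^{TC_k^{vtx}}_{x_1}(E)\big)>0$.
   Context: $\dim$ is Hausdorff dimension, $\mathcal L^k$ is Lebesgue measure on $\mathbb R^k$, and $\mathrm{Area}(x,y,z)$ is the area of the triangle with vertices $x,y,z$. *)

theory Defs
  imports "HOL-Analysis.Analysis"
begin

text \<open>
  The term \<open>(diam U)\<^sup>s\<close>, with the usual convention for \<open>s = 0\<close> that the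
  empty set contributes 0 and every other set contributes 1
  (in the library, \<open>0 powr 0 = 0\<close>).
\<close>

definition diam_pow :: "real \<Rightarrow> 'a::metric_space set \<Rightarrow> ennreal" where
  "diam_pow s U =
     (if U = {} then 0 else if s = 0 then 1 else ennreal (diameter U powr s))"

text \<open>
  Covering sets are required to be bounded because the library sets the
  diameter of an unbounded set to 0.
\<close>

definition hausdorff_premeasure :: "real \<Rightarrow> real \<Rightarrow> 'a::metric_space set \<Rightarrow> ennreal" where
  "hausdorff_premeasure s \<delta> A =
     (INF U \<in> {U :: nat \<Rightarrow> 'a set. A \<subseteq> (\<Union>n. U n) \<and> (\<forall>n. bounded (U n) \<and> diameter (U n) \<le> \<delta>)}.
        \<Sum>n. diam_pow s (U n))"

definition hausdorff_measure :: "real \<Rightarrow> 'a::metric_space set \<Rightarrow> ennreal" where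
  "hausdorff_measure s A = (SUP \<delta> \<in> {0<..}. hausdorff_premeasure s \<delta> A)"

definition hausdorff_dim :: "'a::metric_space set \<Rightarrow> ennreal" where
  "hausdorff_dim A = Inf {ennreal s | s. 0 \<le> s \<and> hausdorff_measure s A = 0}"

definition triangle_area :: "real^2 \<Rightarrow> real^2 \<Rightarrow> real^2 \<Rightarrow> real" where
  "triangle_area x y z = measure lebesgue (convex hull {x, y, z})"

text \<open>
  Points of \<open>\<real>\<^sup>k\<close> are functions on \<open>{1..k}\<close>, extended by \<open>undefined\<close> outside
  (as in \<^const>\<open>PiM\<close>), since the dimension \<open>k\<close> is a variable natural number.
\<close>

definition lebesgue_pow :: "nat \<Rightarrow> (nat \<Rightarrow> real) measure" where
  "lebesgue_pow k = completion (\<Pi>\<^sub>M i\<in>{1..k}. lborel)"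

definition area_chain_set :: "nat \<Rightarrow> (real^2) set \<Rightarrow> real^2 \<Rightarrow> (nat \<Rightarrow> real) set" where
  "area_chain_set k E x1 =
     {\<lambda>i\<in>{1..k}. triangle_area (x (2*i - 1)) (x (2*i)) (x (2*i + 1)) | x :: nat \<Rightarrow> real^2.
        x 1 = x1 \<and> (\<forall>j\<in>{2..2*k+1}. x j \<in> E) \<and> inj_on x {2..2*k+1}}"

end

theory Submission
  imports Defs
begin

text \<open>
  Let \<open>\<mu>\<close> be a Frostman measure on \<open>E\<close> of exponent \<open>s > 1\<close>; it has finite Riesz 1-energy. For the
  projections \<open>\<pi>\<^sub>a x = x\<^sub>2 - a x\<^sub>1\<close> let \<open>S a\<close> be the squared \<open>L\<^sup>2\<close>-norm of the image of \<open>\<mu>\<close>. Marstrand's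
  averaging argument bounds the integral of \<open>S\<close> over bounded sets of slopes by the 1-energy, and
  \<open>\<pi>\<^sub>a \<mu>\<close> is absolutely continuous whenever \<open>S a\<close> is finite. The distribution of the slopes of
  \<open>x - y\<close> under \<open>\<mu> \<times> \<mu>\<close> has a density bounded by a multiple of \<open>S\<close>, so for almost all pairs
  \<open>(x, y)\<close> the slope of \<open>x - y\<close> is one for which \<open>S\<close> is finite. The area of \<open>x, y, z\<close> is proportional
  to \<open>\<bar>\<pi>\<^sub>a z - \<pi>\<^sub>a x\<bar>\<close> for this slope \<open>a\<close>; thus, with \<open>x\<close> and \<open>y\<close> fixed, the areas obtained from
  \<open>\<mu>\<close>-almost all \<open>z\<close> are not contained in a null set. These \<open>z\<close> serve as pins for the next
  triangle, and Fubini's theorem gives the result by induction on the number of triangles.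
\<close>

section \<open>Frostman measures in the plane\<close>

text \<open>The exponent \<open>s > 1\<close> enters through two facts: the kernel
  \<open>1 / dist x y\<close> has integrals bounded uniformly in \<open>x\<close>, and vertical
  lines, hence points, are null. The second allows slopes in place of angles as parameters and lets
  finitely many used vertices be discarded at each stage, so distinctness of the vertices costs
  nothing. The obstacle is that averaging yields finite energy only for Lebesgue-almost every slope,
  while the slopes that matter come from pairs of points of \<open>E\<close> and might a priori all
  be exceptional. The energy itself excludes this, because it is locally integrable in the slope and
  also dominates the distribution of the slopes. To iterate, the third vertex has to be a pin again.
  Pins are therefore asked to be good for almost every second vertex, a condition that holds
  \<open>\<mu>\<close>-almost everywhere, so discarding bad third vertices loses only a null set.
  The conclusion about areas is phrased as escaping every null set: this asks no measurability of
  the set of areas, and the Fubini step uses just one area outside a given null set.\<close>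

lemma hausdorff_premeasure_mono:
  assumes "A \<subseteq> B"
  shows "hausdorff_premeasure s \<delta> A \<le> hausdorff_premeasure s \<delta> B"
  unfolding hausdorff_premeasure_def
  by (rule INF_superset_mono) (use assms in auto)

lemma hausdorff_premeasure_le_diam_pow:
  fixes A :: "'a::metric_space set"
  assumes "bounded A" "diameter A \<le> \<delta>" "\<delta> \<ge> 0"
  shows "hausdorff_premeasure s \<delta> A \<le> diam_pow s A"
proof -
  define U where "U = (\<lambda>n::nat. if n = 0 then A else {})"
  have "hausdorff_premeasure s \<delta> A \<le> (\<Sum>n. diam_pow s (U n))"
    unfolding hausdorff_premeasure_def
    by (rule INF_lower) (use assms in \<open>auto simp: U_def\<close>)
  also have "\<dots> = (\<Sum>n\<in>{0}. diam_pow s (U n))"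
    by (rule suminf_finite) (auto simp: U_def diam_pow_def)
  finally show ?thesis by (simp add: U_def)
qed

lemma hausdorff_premeasure_Un:
  fixes A B :: "'a::metric_space set"
  shows "hausdorff_premeasure s \<delta> (A \<union> B) \<le> hausdorff_premeasure s \<delta> A + hausdorff_premeasure s \<delta> B"
proof -
  define cov where "cov = (\<lambda>A. {U :: nat \<Rightarrow> 'a set. A \<subseteq> (\<Union>n. U n) \<and> (\<forall>n. bounded (U n) \<and> diameter (U n) \<le> \<delta>)})"
  have union_le: "hausdorff_premeasure s \<delta> (A \<union> B) \<le> (\<Sum>n. diam_pow s (U n)) + (\<Sum>n. diam_pow s (V n))"
    if "U \<in> cov A" "V \<in> cov B" for U V
  proof -
    define W where "W = (\<lambda>n. if even n then U (n div 2) else V (n div 2))"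
    have W: "W (2*n) = U n" "W (Suc (2*n)) = V n" for n by (auto simp: W_def)
    have "A \<union> B \<subseteq> (\<Union>n. W n)"
      using that unfolding cov_def by (auto) (metis UN_iff UNIV_I W subsetD)+
    moreover have "\<forall>n. bounded (W n) \<and> diameter (W n) \<le> \<delta>" using that by (auto simp: W_def cov_def)
    ultimately have "hausdorff_premeasure s \<delta> (A \<union> B) \<le> (\<Sum>n. diam_pow s (W n))"
      unfolding hausdorff_premeasure_def by (intro INF_lower) auto
    also have "\<dots> = (\<Sum>n. diam_pow s (W (2*n)) + diam_pow s (W (Suc (2*n))))"
    proof -
      have "(\<lambda>n. diam_pow s (W n)) sums (\<Sum>n. diam_pow s (W n))" by (intro summable_sums) simp
      from sums_group[OF this, of 2]
      have "(\<lambda>n. \<Sum>i=n*2..<n*2+2. diam_pow s (W i)) sums (\<Sum>n. diam_pow s (W n))" by simp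
      moreover have "(\<Sum>i=n*2..<n*2+2. diam_pow s (W i)) = diam_pow s (W (2*n)) + diam_pow s (W (Suc (2*n)))" for n
        by (simp add: mult.commute)
      ultimately show ?thesis by (simp add: sums_iff)
    qed
    also have "\<dots> = (\<Sum>n. diam_pow s (U n)) + (\<Sum>n. diam_pow s (V n))"
      unfolding W by (rule suminf_add[symmetric]) auto
    finally show ?thesis .
  qed
  have pre: "hausdorff_premeasure s \<delta> A = (INF U\<in>cov A. \<Sum>n. diam_pow s (U n))" for A
    by (simp add: hausdorff_premeasure_def cov_def)
  show ?thesis
  proof (rule ennreal_le_epsilon)
    fix e :: real
    assume fin: "hausdorff_premeasure s \<delta> A + hausdorff_premeasure s \<delta> B < top" and e: "e > 0"
    have *: "\<exists>U\<in>cov C. (\<Sum>n. diam_pow s (U n)) < hausdorff_premeasure s \<delta> C + ennreal (e/2)"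
      if "hausdorff_premeasure s \<delta> C < top" for C
    proof -
      have "hausdorff_premeasure s \<delta> C < hausdorff_premeasure s \<delta> C + ennreal (e/2)"
        using that e by (simp add: ennreal_add_left_cancel_less[where b=0, simplified])
      then show ?thesis by (simp add: pre INF_less_iff)
    qed
    obtain U V where UV: "U \<in> cov A" "V \<in> cov B"
      "(\<Sum>n. diam_pow s (U n)) < hausdorff_premeasure s \<delta> A + ennreal (e/2)"
      "(\<Sum>n. diam_pow s (V n)) < hausdorff_premeasure s \<delta> B + ennreal (e/2)"
      using *[of A] *[of B] fin by auto
    have "hausdorff_premeasure s \<delta> (A \<union> B) \<le> (\<Sum>n. diam_pow s (U n)) + (\<Sum>n. diam_pow s (V n))"
      by (rule union_le[OF UV(1,2)])
    also have "\<dots> \<le> (hausdorff_premeasure s \<delta> A + ennreal (e/2)) + (hausdorff_premeasure s \<delta> B + ennreal (e/2))"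
      using UV by (intro add_mono) auto
    also have "\<dots> = hausdorff_premeasure s \<delta> A + hausdorff_premeasure s \<delta> B + (ennreal (e/2) + ennreal (e/2))"
      by (simp add: ac_simps)
    also have "ennreal (e/2) + ennreal (e/2) = ennreal e" using e by (simp flip: ennreal_plus)
    finally show "hausdorff_premeasure s \<delta> (A \<union> B) \<le> hausdorff_premeasure s \<delta> A + hausdorff_premeasure s \<delta> B + ennreal e" .
  qed
qed

text \<open>A cover whose sum is below \<open>\<delta> powr s\<close> contains only sets of diameter
  at most \<open>\<delta>\<close>, so a cheap enough cover meets any size restriction by itself.
  Vanishing at one scale \<open>D\<close> therefore forces the whole Hausdorff measure to
  vanish.\<close>

lemma hausdorff_premeasure_eq_0:
  fixes A :: "'a::metric_space set"
  assumes "hausdorff_premeasure s D A = 0" "s > 0" "\<delta> > 0"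
  shows "hausdorff_premeasure s \<delta> A = 0"
proof -
  have "hausdorff_premeasure s \<delta> A \<le> e" if "e > 0" for e :: ennreal
  proof -
    define e' where "e' = min e (ennreal (\<delta> powr s))"
    have "e' > 0" using that assms by (auto simp: e'_def)
    then have "hausdorff_premeasure s D A < e'" using assms by simp
    then obtain U where U: "A \<subseteq> (\<Union>n. U n)" "\<And>n. bounded (U n)" "(\<Sum>n. diam_pow s (U n)) < e'"
      unfolding hausdorff_premeasure_def INF_less_iff by auto
    have "diameter (U n) \<le> \<delta>" for n
    proof (cases "U n = {}")
      case True
      then show ?thesis using assms by simp
    next
      case False
      have "diam_pow s (U n) \<le> (\<Sum>n. diam_pow s (U n))"
        using sum_le_suminf[of "\<lambda>n. diam_pow s (U n)" "{n}"] by simp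
      also have "\<dots> < ennreal (\<delta> powr s)" using U(3) by (simp add: e'_def)
      finally have "ennreal (diameter (U n) powr s) < ennreal (\<delta> powr s)"
        using False assms by (simp add: diam_pow_def)
      then have "diameter (U n) powr s < \<delta> powr s" by (simp add: ennreal_less_iff)
      then show ?thesis using assms powr_mono2[of s \<delta> "diameter (U n)"] by (cases "diameter (U n) \<le> \<delta>") auto
    qed
    then have "hausdorff_premeasure s \<delta> A \<le> (\<Sum>n. diam_pow s (U n))"
      unfolding hausdorff_premeasure_def using U by (intro INF_lower) auto
    then show ?thesis using U(3) by (auto simp: e'_def intro: order_trans less_imp_le)
  qed
  then show ?thesis by (metis bot.not_eq_extremum bot_ennreal dense linorder_not_less)
qed

text \<open>Strictness leaves room for an exponent between \<open>t\<close> and the dimension, where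
  the measure is nonzero. The preceding lemma moves this positivity to each single scale; Frostman's
  theorem uses it at \<open>D = diameter E\<close>.\<close>

lemma hausdorff_dim_gt_imp:
  fixes A :: "'a::metric_space set"
  assumes "hausdorff_dim A > ennreal t" "t \<ge> 0"
  obtains s where "s > t" "\<And>D. hausdorff_premeasure s D A > 0"
proof -
  obtain y where y: "ennreal t < y" "y < hausdorff_dim A" using assms dense by blast
  then obtain s where s: "y = ennreal s" "s \<ge> 0"
    by (cases y) (auto simp: top_unique)
  have st: "s > t" using y s assms by (simp add: ennreal_less_iff)
  have "hausdorff_measure s A \<noteq> 0"
  proof
    assume "hausdorff_measure s A = 0"
    then have "hausdorff_dim A \<le> ennreal s"
      unfolding hausdorff_dim_def using s(2) by (intro Inf_lower) auto
    then show False using y s by simp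
  qed
  moreover have "hausdorff_measure s A = 0" if "hausdorff_premeasure s D A = 0" for D
    unfolding hausdorff_measure_def
    using hausdorff_premeasure_eq_0[OF that] st assms by (simp add: SUP_eq_iff)
  ultimately show ?thesis using that[OF st] by (metis zero_less_iff_neq_zero)
qed

section \<open>Mass distribution on a binary tree\<close>

text \<open>
  Splitting the mass of a node among its children in proportion to \<open>t\<close> keeps it below \<open>t\<close>,
  by subadditivity. Every node of the tree moreover owns a subinterval of \<open>[0, t [])\<close> whose length
  is its mass, so that Lebesgue measure on \<open>[0, t [])\<close> realises all the masses at once and no
  extension theorem is needed. Words are read from the right: \<open>b # w\<close> is a child of \<open>w\<close>.
\<close>

locale binary_tree_content =
  fixes t :: "bool list \<Rightarrow> real"
  assumes t_nonneg: "t w \<ge> 0"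
    and t_subadd: "t w \<le> t (True # w) + t (False # w)"
begin

primrec mass :: "bool list \<Rightarrow> real" where
  "mass [] = t []"
| "mass (b # w) = mass w * t (b # w) / (t (True # w) + t (False # w))"

primrec left_end :: "bool list \<Rightarrow> real" where
  "left_end [] = 0"
| "left_end (b # w) = (if b then left_end w else left_end w + mass (True # w))"

primrec branch :: "real \<Rightarrow> nat \<Rightarrow> bool list" where
  "branch u 0 = []"
| "branch u (Suc n) = (u < left_end (branch u n) + mass (True # branch u n)) # branch u n"

lemma length_branch [simp]: "length (branch u n) = n"
  by (induction n) auto

lemma mass_bounds: "0 \<le> mass w \<and> mass w \<le> t w"
proof (induction w)
  case (Cons b w)
  let ?s = "t (True # w) + t (False # w)"
  have s: "?s \<ge> 0" using t_nonneg[of "True # w"] t_nonneg[of "False # w"] by simp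
  have "mass w / ?s \<le> 1" using Cons t_subadd[of w] s by (auto simp: divide_le_eq_1)
  moreover have "mass w / ?s \<ge> 0" using Cons s by simp
  ultimately have "mass w / ?s * t (b # w) \<le> 1 * t (b # w)" "mass w / ?s * t (b # w) \<ge> 0"
    using t_nonneg[of "b # w"] by (blast intro: mult_right_mono mult_nonneg_nonneg)+
  then show ?case by simp
qed (use t_nonneg in auto)

lemma mass_children: "mass (True # w) + mass (False # w) = mass w"
proof (cases "t (True # w) + t (False # w) = 0")
  case True
  \<comment> \<open>If both children have content 0, then so has \<open>w\<close>, and the value 0
    of the division by zero is the right mass.\<close>
  then have "t w = 0" using t_subadd[of w] t_nonneg[of w] by simp
  then have "mass w = 0" using mass_bounds[of w] by simp
  then show ?thesis by simp
next
  case False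
  then show ?thesis by (simp flip: add_divide_distrib distrib_left)
qed

text \<open>By \<open>mass_children\<close> the intervals of the two children partition that of the
  parent, with \<open>True\<close> on the left. So the parameters \<open>u\<close> passing through a
  given node form an interval, which yields both measurability and the mass bound.\<close>

lemma branch_eq_iff:
  assumes "0 \<le> u" "u < t []"
  shows "branch u (length w) = w \<longleftrightarrow> left_end w \<le> u \<and> u < left_end w + mass w"
proof (induction w)
  case (Cons b w)
  have "mass (True # w) \<ge> 0" "mass (False # w) \<ge> 0" using mass_bounds by blast+
  moreover note mass_children[of w]
  ultimately show ?case using Cons
    by (cases b) (auto simp del: mass.simps(2) simp: if_distrib)
qed (use assms in auto)

text \<open>A half-open interval containing \<open>u\<close> has positive length. This guarantees
  that all cells along a branch are nonempty, so that points can be picked from them.\<close>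

lemma t_branch_pos:
  assumes "0 \<le> u" "u < t []"
  shows "t (branch u n) > 0"
  using branch_eq_iff[OF assms, of "branch u n"] mass_bounds[of "branch u n"] by auto

lemma branch_vimage: "{u\<in>{0..<t []}. branch u (length w) = w} = {0..<t []} \<inter> {left_end w..<left_end w + mass w}"
  using branch_eq_iff by auto

lemma emeasure_branch_le: "emeasure lborel {u\<in>{0..<t []}. branch u (length w) = w} \<le> ennreal (t w)"
proof -
  have "emeasure lborel {u\<in>{0..<t []}. branch u (length w) = w} \<le> emeasure lborel {left_end w..<left_end w + mass w}"
    unfolding branch_vimage by (intro emeasure_mono) auto
  also have "\<dots> \<le> ennreal (t w)" using mass_bounds[of w] by simp
  finally show ?thesis .
qed

lemma measurable_branch [measurable]:
  "(\<lambda>u. branch u n) \<in> measurable (restrict_space lborel {0..<t []}) (count_space UNIV)"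
proof -
  let ?M = "restrict_space lborel {0..<t []}"
  have "(\<lambda>u. branch u n) -` {w} \<inter> space ?M \<in> sets ?M" for w
  proof -
    have "(\<lambda>u. branch u n) -` {w} \<inter> space ?M =
        (if length w = n then {u\<in>{0..<t []}. branch u (length w) = w} else {})"
      by (auto simp: space_restrict_space)
    moreover have "{0..<t []} \<inter> {left_end w..<left_end w + mass w} \<in> sets ?M"
      unfolding sets_restrict_space by (rule imageI) simp
    ultimately show ?thesis unfolding branch_vimage by (simp split: if_splits)
  qed
  then show ?thesis
    by (subst measurable_count_space_eq_countable) simp_all
qed

end

section \<open>Dyadic cells as a binary tree\<close>

text \<open>
  Squares are halved alternately in the two coordinate directions: the state of a cell of level
  \<open>n\<close> is \<open>(grid_index n, grid_index (n + 1))\<close>, so that the coordinate to be halved next comes first.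
\<close>

definition grid_index :: "nat \<Rightarrow> real^2 \<Rightarrow> int" where
  "grid_index n x = \<lfloor>2 ^ (n div 2) * x $ (if even n then 1 else 2)\<rfloor>"

lemma grid_index_Suc_Suc: "grid_index (Suc (Suc n)) x div 2 = grid_index n x"
proof -
  have "\<lfloor>2 * y\<rfloor> div 2 = \<lfloor>y\<rfloor>" for y :: real
    using floor_divide_real_eq_div[of 2 "2 * y"] by simp
  then show ?thesis by (simp add: grid_index_def mult.assoc)
qed

primrec grid_state :: "int \<times> int \<Rightarrow> bool list \<Rightarrow> int \<times> int" where
  "grid_state r [] = r"
| "grid_state r (b # w) = (snd (grid_state r w), 2 * fst (grid_state r w) + of_bool b)"

definition grid_cell :: "int \<times> int \<Rightarrow> (real^2) set \<Rightarrow> bool list \<Rightarrow> (real^2) set" where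
  "grid_cell r E w = {x\<in>E. (grid_index (length w) x, grid_index (Suc (length w)) x) = grid_state r w}"

lemma grid_state_inject: "length v = length w \<Longrightarrow> grid_state r v = grid_state r w \<Longrightarrow> v = w"
proof (induction v w rule: list_induct2)
  case (Cons b v c w)
  from Cons.prems have 1: "snd (grid_state r v) = snd (grid_state r w)"
    and 2: "2 * fst (grid_state r v) + of_bool b = 2 * fst (grid_state r w) + (of_bool c :: int)" by auto
  have "b = c \<and> i = j" if "2 * i + of_bool b = 2 * j + (of_bool c :: int)" for i j
    using that by (cases b; cases c; simp; presburger)
  from this[OF 2] have "b = c \<and> fst (grid_state r v) = fst (grid_state r w)" .
  with 1 Cons.IH show ?case by (simp add: prod_eq_iff)
qed auto

lemma grid_cell_split: "grid_cell r E w = grid_cell r E (True # w) \<union> grid_cell r E (False # w)"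
proof -
  have *: "grid_index n x = p \<longleftrightarrow> grid_index (Suc (Suc n)) x = 2 * p + 1 \<or> grid_index (Suc (Suc n)) x = 2 * p" for n x p
    using grid_index_Suc_Suc[of n x] by presburger
  show ?thesis unfolding grid_cell_def
    using *[of "length w"] by (auto simp: prod_eq_iff)
qed

lemma grid_cell_subset: "grid_cell r E (b # w) \<subseteq> grid_cell r E w"
  using grid_cell_split[of r E w] by (cases b) auto

lemma floor_scaled_eq_imp:
  fixes x y :: real
  assumes "\<lfloor>2 ^ n * x\<rfloor> = \<lfloor>2 ^ n * y\<rfloor>"
  shows "\<bar>x - y\<bar> \<le> 1 / 2 ^ n"
proof -
  have "\<bar>2 ^ n * x - 2 ^ n * y\<bar> \<le> 1" using assms by linarith
  then have "2 ^ n * \<bar>x - y\<bar> \<le> 1" by (simp add: abs_mult flip: right_diff_distrib)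
  then show ?thesis by (simp add: field_simps)
qed

lemma dist_le_coordinates:
  fixes x y :: "real^2"
  shows "dist x y \<le> \<bar>x $ 1 - y $ 1\<bar> + \<bar>x $ 2 - y $ 2\<bar>"
  using norm_le_l1_cart[of "x - y"] by (simp add: dist_norm sum_2)

lemma grid_cell_dist_le:
  assumes "x \<in> grid_cell r E w" "y \<in> grid_cell r E w" "length w = 2 * n"
  shows "dist x y \<le> 2 / 2 ^ n"
proof -
  have "\<lfloor>2 ^ n * x $ i\<rfloor> = \<lfloor>2 ^ n * y $ i\<rfloor>" for i :: 2
    using assms exhaust_2[of i] by (auto simp: grid_cell_def grid_index_def prod_eq_iff)
  then have "\<bar>x $ i - y $ i\<bar> \<le> 1 / 2 ^ n" for i by (intro floor_scaled_eq_imp)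
  from this[of 1] this[of 2] show ?thesis using dist_le_coordinates[of x y] by simp
qed

text \<open>The radius \<open>3 / 2 ^ n\<close> is a ball radius of at most \<open>1 / 2 ^ n\<close>
  plus the distance \<open>2 / 2 ^ n\<close> between a limit point and the cells of its branch.
  Scaled coordinates then differ by at most 3 and their floors by at most 4, which leaves 9 * 9 = 81
  cells.\<close>

lemma card_grid_cells_near:
  fixes x :: "real^2" and E :: "(real^2) set" and r :: "int \<times> int"
  defines "W \<equiv> \<lambda>n. {w. length w = 2 * n \<and> (\<exists>y\<in>grid_cell r E w. dist x y \<le> 3 / 2 ^ n)}"
  shows "finite (W n)" "card (W n) \<le> 81"
proof -
  define R where "R = {\<lfloor>2^n * x$1\<rfloor>-4..\<lfloor>2^n * x$1\<rfloor>+4} \<times> {\<lfloor>2^n * x$2\<rfloor>-4..\<lfloor>2^n * x$2\<rfloor>+4}"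
  have inj: "inj_on (grid_state r) (W n)"
    by (auto simp: inj_on_def W_def intro: grid_state_inject)
  have sub: "grid_state r ` W n \<subseteq> R"
  proof (rule image_subsetI)
    fix w assume "w \<in> W n"
    then obtain y where y: "length w = 2 * n" "y \<in> grid_cell r E w" "dist x y \<le> 3 / 2 ^ n" by (auto simp: W_def)
    have *: "\<bar>\<lfloor>2^n * x$i\<rfloor> - \<lfloor>2^n * y$i\<rfloor>\<bar> \<le> 4" for i
    proof -
      have "\<bar>x $ i - y $ i\<bar> \<le> 3 / 2 ^ n"
        using component_le_norm_cart[of "x - y" i] y by (simp add: dist_norm)
      then have "2^n * \<bar>x $ i - y $ i\<bar> \<le> 3" by (simp add: field_simps)
      then have "\<bar>2^n * x $ i - 2^n * y $ i\<bar> \<le> 3" by (simp add: abs_mult flip: right_diff_distrib)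
      then show ?thesis by linarith
    qed
    have "grid_state r w = (\<lfloor>2^n * y$1\<rfloor>, \<lfloor>2^n * y$2\<rfloor>)"
      using y by (auto simp: grid_cell_def grid_index_def)
    then show "grid_state r w \<in> R" using *[of 1] *[of 2] by (simp add: R_def; linarith)
  qed
  have R: "finite R" "card R = 81" by (auto simp: R_def)
  show "finite (W n)" by (rule inj_on_finite[OF inj sub R(1)])
  show "card (W n) \<le> 81" using card_inj_on_le[OF inj sub R(1)] R by simp
qed

lemma dyadic_scale:
  fixes r :: real
  assumes "0 < r" "r \<le> 1"
  obtains n where "r \<le> 1 / 2 ^ n" "1 / 2 ^ n \<le> 2 * r"
proof -
  define m where "m = (LEAST m. (1/2::real) ^ m < r)"
  have m: "(1/2::real) ^ m < r" unfolding m_def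
    by (rule LeastI_ex) (use assms real_arch_pow_inv[of r "1/2"] in auto)
  then have "m \<noteq> 0" using assms by (intro notI) auto
  then obtain n where n: "m = Suc n" by (cases m) auto
  have "\<not> (1/2::real) ^ n < r" using not_less_Least[of n "\<lambda>m. (1/2::real) ^ m < r"] n m_def by simp
  then show ?thesis using m n by (intro that[of n]) (auto simp: power_divide)
qed

text \<open>The measure is the image of Lebesgue measure under \<open>f\<close>, which sends
  \<open>u\<close> to the limit of points picked from the cells along its branch. The cells are not
  closed, so \<open>f u\<close> may lie outside them, but it stays within \<open>2 / 2 ^ n\<close>
  of the picked point of level \<open>2 * n\<close>. A ball is therefore charged only by cells near
  it, and these are boundedly many.\<close>

theorem frostman_plane:
  fixes E :: "(real^2) set"
  assumes "compact E" and s: "s > 0" and pos: "\<And>D. hausdorff_premeasure s D E > 0"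
  obtains \<mu> :: "(real^2) measure" and C where
    "sets \<mu> = sets borel" "finite_measure \<mu>" "emeasure \<mu> (- E) = 0" "emeasure \<mu> UNIV > 0" "C \<ge> 0"
    "\<And>x r. r > 0 \<Longrightarrow> emeasure \<mu> (cball x r) \<le> ennreal (C * r powr s)"
proof -
  have bE: "bounded E" and clE: "closed E" using assms compact_imp_bounded compact_imp_closed by auto
  \<comment> \<open>For subsets of \<open>E\<close> the size restriction on the covering sets is void, so \<open>T\<close> is a Hausdorff content.\<close>
  define T :: "(real^2) set \<Rightarrow> ennreal" where "T = hausdorff_premeasure s (diameter E)"
  have T_le: "T A \<le> diam_pow s A" if "A \<subseteq> E" for A
    unfolding T_def using that bE
    by (intro hausdorff_premeasure_le_diam_pow) (auto intro: bounded_subset diameter_subset diameter_ge_0)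
  have T_empty: "T {} = 0" using T_le[of "{}"] by (simp add: diam_pow_def)
  have T_fin: "T A < top" if "A \<subseteq> E" for A
    using T_le[OF that] s by (auto simp: diam_pow_def split: if_splits intro: le_less_trans)
  have T_UN: "T (\<Union>i\<in>I. A i) \<le> (\<Sum>i\<in>I. T (A i))" if "finite I" for I :: "(int \<times> int) set" and A
    using that
  proof (induction I rule: finite_induct)
    case (insert i I)
    have "T (\<Union>j\<in>insert i I. A j) \<le> T (A i) + T (\<Union>j\<in>I. A j)"
      unfolding T_def using hausdorff_premeasure_Un[of s _ "A i"] by simp
    also have "\<dots> \<le> T (A i) + (\<Sum>i\<in>I. T (A i))" using insert by (intro add_mono) auto
    finally show ?case using insert by simp
  qed (simp add: T_empty)
  \<comment> \<open>Finitely many unit cells cover \<open>E\<close>, so by subadditivity one of them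
    has positive content; it becomes the root of the tree.\<close>
  obtain r where r: "T (grid_cell r E []) > 0"
  proof -
    obtain B where B: "\<And>x. x \<in> E \<Longrightarrow> norm x \<le> B" using bE unfolding bounded_iff by blast
    define I where "I = {-\<lceil>B\<rceil>-1..\<lceil>B\<rceil>+1} \<times> {-\<lceil>B\<rceil>-1..\<lceil>B\<rceil>+1}"
    have "E \<subseteq> (\<Union>r\<in>I. grid_cell r E [])"
    proof
      fix x assume "x \<in> E"
      have "\<bar>x $ i\<bar> \<le> B" for i using component_le_norm_cart[of x i] B[OF \<open>x \<in> E\<close>] by simp
      moreover have "\<lfloor>z\<rfloor> \<in> {-\<lceil>B\<rceil>-1..\<lceil>B\<rceil>+1}" if "\<bar>z\<bar> \<le> B" for z
        using that unfolding atLeastAtMost_iff by linarith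
      ultimately have "\<lfloor>x $ i\<rfloor> \<in> {-\<lceil>B\<rceil>-1..\<lceil>B\<rceil>+1}" for i by blast
      then have "(\<lfloor>x $ 1\<rfloor>, \<lfloor>x $ 2\<rfloor>) \<in> I" by (simp add: I_def)
      moreover have "x \<in> grid_cell (\<lfloor>x $ 1\<rfloor>, \<lfloor>x $ 2\<rfloor>) E []"
        using \<open>x \<in> E\<close> by (simp add: grid_cell_def grid_index_def)
      ultimately show "x \<in> (\<Union>r\<in>I. grid_cell r E [])" by blast
    qed
    then have "T E \<le> T (\<Union>r\<in>I. grid_cell r E [])" unfolding T_def by (rule hausdorff_premeasure_mono)
    also have "\<dots> \<le> (\<Sum>r\<in>I. T (grid_cell r E []))" by (rule T_UN) (simp add: I_def)
    finally have "(\<Sum>r\<in>I. T (grid_cell r E [])) > 0" using pos[of "diameter E"] by (simp add: T_def)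
    then show ?thesis using that by (metis (no_types, lifting) not_gr_zero order_less_irrefl sum.neutral)
  qed
  define t where "t = (\<lambda>w. enn2real (T (grid_cell r E w)))"
  have cellE: "grid_cell r E w \<subseteq> E" for w by (auto simp: grid_cell_def)
  have T_t: "T (grid_cell r E w) = ennreal (t w)" for w
    using T_fin[OF cellE] by (simp add: t_def)
  interpret binary_tree_content t
  proof
    show "0 \<le> t w" for w by (simp add: t_def)
    show "t w \<le> t (True # w) + t (False # w)" for w
    proof -
      have "T (grid_cell r E w) \<le> T (grid_cell r E (True # w)) + T (grid_cell r E (False # w))"
        unfolding T_def grid_cell_split[of r E w] by (rule hausdorff_premeasure_Un)
      then show ?thesis unfolding T_t by (simp add: t_def flip: ennreal_plus)
    qed
  qed
  have t_le: "t w \<le> (2 / 2 ^ n) powr s" if "length w = 2 * n" for w n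
  proof -
    have "diameter (grid_cell r E w) \<le> 2 / 2 ^ n"
      by (rule diameter_le) (use grid_cell_dist_le[OF _ _ that] in \<open>auto simp: dist_norm\<close>)
    then have "diam_pow s (grid_cell r E w) \<le> ennreal ((2 / 2 ^ n) powr s)"
      using s bE cellE[of w] by (auto simp: diam_pow_def intro!: ennreal_leI powr_mono2 diameter_ge_0 intro: bounded_subset)
    then have "ennreal (t w) \<le> ennreal ((2 / 2 ^ n) powr s)"
      using T_le[OF cellE[of w]] unfolding T_t by (rule order_trans[rotated])
    then show ?thesis by (subst (asm) ennreal_le_iff) auto
  qed
  have t0: "t [] > 0" using r T_t[of "[]"] by simp
  define p where "p = (\<lambda>w. SOME x. x \<in> grid_cell r E w)"
  have p: "p w \<in> grid_cell r E w" if "t w > 0" for w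
  proof -
    have "grid_cell r E w \<noteq> {}" using that T_t[of w] T_empty by (intro notI) simp
    then show ?thesis unfolding p_def by (simp add: some_in_eq)
  qed
  have p_branch: "p (branch u (m + k)) \<in> grid_cell r E (branch u m)" if "u \<in> {0..<t []}" for u m k
  proof -
    have "grid_cell r E (branch u (m + k)) \<subseteq> grid_cell r E (branch u m)"
    proof (induction k)
      case (Suc k)
      then show ?case using grid_cell_subset[of r E _ "branch u (m + k)"] by fastforce
    qed simp
    then show ?thesis using p[OF t_branch_pos, of u "m + k"] that by auto
  qed
  define f where "f = (\<lambda>u. lim (\<lambda>n. p (branch u (2 * n))))"
  have dist_p: "dist (p (branch u (2 * n))) (p (branch u (2 * m))) \<le> 2 / 2 ^ n"
    if "u \<in> {0..<t []}" "n \<le> m" for u n m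
    using p_branch[OF that(1), of "2*n" 0] p_branch[OF that(1), of "2*n" "2*(m-n)"] that(2)
    by (intro grid_cell_dist_le[of _ r E "branch u (2 * n)"]) (auto simp flip: add_mult_distrib2)
  have lim_f: "(\<lambda>n. p (branch u (2 * n))) \<longlonglongrightarrow> f u" if "u \<in> {0..<t []}" for u
  proof -
    have "Cauchy (\<lambda>n. p (branch u (2 * n)))"
    proof (rule metric_CauchyI)
      fix e :: real assume "e > 0"
      have "(\<lambda>n. 4 / 2 ^ n :: real) \<longlonglongrightarrow> 0" by (rule LIMSEQ_divide_realpow_zero) simp
      then obtain M where M: "4 / 2 ^ M < e" using \<open>e > 0\<close> by (metis order_tendstoD(2) eventually_sequentially order_refl)
      have "dist (p (branch u (2 * m))) (p (branch u (2 * n))) < e" if "m \<ge> M" "n \<ge> M" for m n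
        using dist_p[OF \<open>u \<in> _\<close> that(1)] dist_p[OF \<open>u \<in> _\<close> that(2)] M
          dist_triangle3[of "p (branch u (2 * m))" "p (branch u (2 * n))" "p (branch u (2 * M))"] by simp
      then show "\<exists>M. \<forall>m\<ge>M. \<forall>n\<ge>M. dist (p (branch u (2 * m))) (p (branch u (2 * n))) < e" by blast
    qed
    then show ?thesis unfolding f_def by (metis Cauchy_convergent convergent_LIMSEQ_iff)
  qed
  have f_E: "f u \<in> E" if "u \<in> {0..<t []}" for u
  proof (rule closed_sequentially[OF clE _ lim_f[OF that]])
    show "p (branch u (2 * n)) \<in> E" for n
      using p_branch[OF that, of "2 * n" 0] cellE by auto
  qed
  have dist_f: "dist (p (branch u (2 * n))) (f u) \<le> 2 / 2 ^ n" if "u \<in> {0..<t []}" for u n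
    by (rule Lim_dist_ubound[OF _ lim_f[OF that]])
       (auto intro!: exI[of _ n] dist_p that simp: eventually_sequentially)
  let ?R = "restrict_space lborel {0..<t []}"
  have spR: "space ?R = {0..<t []}" by (simp add: space_restrict_space)
  have f_meas [measurable]: "f \<in> borel_measurable ?R"
  proof (rule borel_measurable_LIMSEQ_metric[where f = "\<lambda>n u. p (branch u (2 * n))"])
    show "(\<lambda>u. p (branch u (2 * n))) \<in> borel_measurable ?R" for n
      by (rule measurable_compose[OF measurable_branch]) simp
  qed (use lim_f spR in auto)
  define \<mu> where "\<mu> = distr ?R borel f"
  have em: "emeasure \<mu> A = emeasure lborel {u\<in>{0..<t []}. f u \<in> A}" if "A \<in> sets borel" for A
  proof -
    have "emeasure \<mu> A = emeasure ?R (f -` A \<inter> space ?R)" unfolding \<mu>_def by (rule emeasure_distr[OF f_meas that])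
    also have "\<dots> = emeasure lborel (f -` A \<inter> space ?R)" by (rule emeasure_restrict_space) (auto simp: spR)
    also have "f -` A \<inter> space ?R = {u\<in>{0..<t []}. f u \<in> A}" by (auto simp: spR)
    finally show ?thesis .
  qed
  have tot: "emeasure \<mu> UNIV = ennreal (t [])" 
  proof -
    have "{u\<in>{0..<t []}. f u \<in> UNIV} = {0..<t []}" by auto
    then show ?thesis using em[of UNIV] t0 by simp
  qed
  \<comment> \<open>The first summand serves radii up to 1: at most 81 cells, each of mass at most
    \<open>(2 / 2 ^ n) powr s \<le> (4 * \<rho>) powr s\<close>. The second is the total mass and
    serves larger radii, where \<open>\<rho> powr s \<ge> 1\<close>.\<close>
  define C where "C = 81 * 4 powr s + t []"
  have branch_set: "{u\<in>{0..<t []}. branch u (length w) = w} \<in> sets lborel" for w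
    unfolding branch_vimage by simp
  have small: "emeasure \<mu> (cball x \<rho>) \<le> ennreal (81 * 4 powr s * \<rho> powr s)" if \<rho>: "0 < \<rho>" "\<rho> \<le> 1" for x \<rho>
  proof -
    obtain n where n: "\<rho> \<le> 1 / 2 ^ n" "1 / 2 ^ n \<le> 2 * \<rho>" using dyadic_scale[OF \<rho>] by blast
    define W where "W = {w. length w = 2 * n \<and> (\<exists>y\<in>grid_cell r E w. dist x y \<le> 3 / 2 ^ n)}"
    have W: "finite W" "card W \<le> 81" using card_grid_cells_near[of n r E x] by (simp_all add: W_def)
    have "{u\<in>{0..<t []}. f u \<in> cball x \<rho>} \<subseteq> (\<Union>w\<in>W. {u\<in>{0..<t []}. branch u (length w) = w})"
    proof safe
      fix u assume u: "u \<in> {0..<t []}" "f u \<in> cball x \<rho>"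
      have "dist x (p (branch u (2*n))) \<le> dist x (f u) + dist (p (branch u (2*n))) (f u)" by (metis dist_commute dist_triangle)
      also have "\<dots> \<le> 3 / 2 ^ n" using u n dist_f[OF u(1), of n] by simp
      finally have "branch u (2 * n) \<in> W" using p_branch[OF u(1), of "2*n" 0] by (auto simp: W_def)
      then show "u \<in> (\<Union>w\<in>W. {u\<in>{0..<t []}. branch u (length w) = w})" using u by (auto intro!: bexI[of _ "branch u (2*n)"])
    qed
    then have "emeasure lborel {u\<in>{0..<t []}. f u \<in> cball x \<rho>} \<le> emeasure lborel (\<Union>w\<in>W. {u\<in>{0..<t []}. branch u (length w) = w})"
      by (rule emeasure_mono) (intro sets.finite_UN W branch_set)
    also have "\<dots> \<le> (\<Sum>w\<in>W. emeasure lborel {u\<in>{0..<t []}. branch u (length w) = w})"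
      using W branch_set by (intro emeasure_subadditive_finite) auto
    also have "\<dots> \<le> (\<Sum>w\<in>W. ennreal ((4 * \<rho>) powr s))"
    proof (rule sum_mono)
      fix w assume "w \<in> W"
      have "emeasure lborel {u\<in>{0..<t []}. branch u (length w) = w} \<le> ennreal (t w)" by (rule emeasure_branch_le)
      also have "t w \<le> (2 / 2 ^ n) powr s" using \<open>w \<in> W\<close> by (intro t_le) (simp add: W_def)
      also have "\<dots> \<le> (4 * \<rho>) powr s" using n s by (intro powr_mono2) auto
      finally show "emeasure lborel {u\<in>{0..<t []}. branch u (length w) = w} \<le> ennreal ((4 * \<rho>) powr s)"
        by (simp add: ennreal_leI)
    qed
    also have "\<dots> = ennreal (card W * (4 * \<rho>) powr s)" by (simp add: ennreal_mult' ennreal_of_nat_eq_real_of_nat)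
    also have "\<dots> \<le> ennreal (81 * (4 * \<rho>) powr s)" using W by (intro ennreal_leI mult_right_mono) auto
    also have "81 * (4 * \<rho>) powr s = 81 * 4 powr s * \<rho> powr s" using \<rho> by (simp add: powr_mult)
    finally show ?thesis using em[of "cball x \<rho>"] by simp
  qed
  have ball: "emeasure \<mu> (cball x \<rho>) \<le> ennreal (C * \<rho> powr s)" if "\<rho> > 0" for x \<rho>
  proof (cases "\<rho> \<le> 1")
    case True
    have "81 * 4 powr s * \<rho> powr s \<le> C * \<rho> powr s" using t0 by (simp add: C_def mult_right_mono)
    then show ?thesis using small[OF that True, of x] by (meson ennreal_leI order_trans)
  next
    case False
    have "emeasure \<mu> (cball x \<rho>) \<le> emeasure \<mu> UNIV" by (rule emeasure_mono) (auto simp: \<mu>_def)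
    also have "\<dots> \<le> ennreal (C * 1)" unfolding tot C_def by (intro ennreal_leI) simp
    also have "\<dots> \<le> ennreal (C * \<rho> powr s)" using False s t0
      by (intro ennreal_leI mult_left_mono ge_one_powr_ge_zero) (auto simp: C_def)
    finally show ?thesis .
  qed
  show ?thesis
  proof (rule that[of \<mu> C])
    show "sets \<mu> = sets borel" by (simp add: \<mu>_def)
    show "finite_measure \<mu>" by (rule finite_measureI) (use tot in \<open>simp add: \<mu>_def\<close>)
    have "{u\<in>{0..<t []}. f u \<in> - E} = {}" using f_E by auto
    moreover have "emeasure \<mu> (- E) = emeasure lborel {u\<in>{0..<t []}. f u \<in> - E}"
      by (rule em) (use clE in auto)
    ultimately show "emeasure \<mu> (- E) = 0" by (simp only: emeasure_empty)
    show "emeasure \<mu> UNIV > 0" using tot t0 by simp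
    show "C \<ge> 0" using t0 by (simp add: C_def)
  qed (rule ball)
qed

section \<open>Square-integrable densities on the line\<close>

lemma ennreal_square_add_le: "(a + b)^2 \<le> 2 * a^2 + 2 * (b::ennreal)^2"
proof (cases "a = top \<or> b = top")
  case False
  then obtain x y where xy: "a = ennreal x" "x \<ge> 0" "b = ennreal y" "y \<ge> 0"
    by (metis ennreal_cases)
  have "(x + y)^2 \<le> 2 * x^2 + 2 * y^2"
    using sum_squares_bound[of x y] by (simp add: power2_sum)
  then have "ennreal ((x + y)^2) \<le> ennreal (2 * x^2 + 2 * y^2)" by (rule ennreal_leI)
  moreover have "ennreal ((x + y)^2) = (a + b)^2"
    using xy by (simp add: ennreal_power flip: ennreal_plus)
  moreover have "ennreal (2 * x^2 + 2 * y^2) = 2 * a^2 + 2 * b^2"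
    using xy by (simp add: ennreal_mult ennreal_power)
  ultimately show ?thesis by (simp only:)
qed (auto simp: power2_eq_square)

text \<open>Completing the square. This replaces the Cauchy-Schwarz inequality: integrated over a
  set \<open>U\<close>, it bounds a mass by \<open>\<tau>\<close> times a square integral plus the
  length of \<open>U\<close> divided by \<open>4 * \<tau>\<close>.\<close>

lemma ennreal_le_square_bound:
  assumes "\<tau> > 0"
  shows "y \<le> ennreal \<tau> * y^2 + ennreal (1 / (4 * \<tau>))"
proof (cases y)
  case (real x)
  have "0 \<le> (2 * \<tau> * x - 1)^2" by simp
  then have "x \<le> \<tau> * x^2 + 1 / (4 * \<tau>)" using assms
    by (simp add: field_simps power2_eq_square)
  then have "ennreal x \<le> ennreal (\<tau> * x^2 + 1 / (4 * \<tau>))" by (rule ennreal_leI)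
  also have "\<dots> = ennreal \<tau> * y^2 + ennreal (1 / (4 * \<tau>))"
    using assms real by (simp add: ennreal_plus ennreal_mult ennreal_power del: ennreal_plus[symmetric])
  finally show ?thesis using real by simp
next
  case top
  then show ?thesis using assms by (simp add: power2_eq_square ennreal_mult_top)
qed

text \<open>Kept as a function of both \<open>t\<close> and \<open>x\<close>, since Fubini arguments
  read it as an indicator in either variable. Half-open windows let one of length
  \<open>2 * \<delta>\<close> split exactly into two of length \<open>\<delta>\<close>.\<close>

definition in_window :: "real \<Rightarrow> real \<Rightarrow> real \<Rightarrow> ennreal" where
  "in_window \<delta> t x = (if t \<le> x \<and> x < t + \<delta> then 1 else 0)"

lemma measurable_in_window [measurable (raw)]:
  assumes [measurable]: "f \<in> borel_measurable M" "g \<in> borel_measurable M"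
  shows "(\<lambda>x. in_window \<delta> (f x) (g x)) \<in> borel_measurable M"
  unfolding in_window_def by measurable

lemma in_window_eq_indicator: "in_window \<delta> t x = indicator {t..<t + \<delta>} x"
  "in_window \<delta> t x = indicator {x - \<delta><..x} t"
  by (auto simp: in_window_def indicator_def)

text \<open>Divided by \<open>\<delta>^2\<close>, this is the squared norm in \<open>L^2\<close> of
  the density of \<open>\<nu>\<close> averaged over windows of length \<open>\<delta>\<close>; hence
  the factor \<open>4 ^ n\<close> at \<open>\<delta> = 1 / 2 ^ n\<close>.\<close>

definition window_energy :: "real measure \<Rightarrow> real \<Rightarrow> ennreal" where
  "window_energy \<nu> \<delta> = (\<integral>\<^sup>+t. (emeasure \<nu> {t..<t + \<delta>})^2 \<partial>lborel)"

text \<open>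
  The terms increase with \<open>n\<close>, and the supremum is the squared \<open>L\<^sup>2\<close>-norm of the density of \<open>\<nu>\<close>.
\<close>

definition L2_energy :: "real measure \<Rightarrow> ennreal" where
  "L2_energy \<nu> = (SUP n. 4 ^ n * window_energy \<nu> (1 / 2 ^ n))"

locale finite_real_measure = finite_measure \<nu> for \<nu> :: "real measure" +
  assumes sets_borel [measurable_cong, simp]: "sets \<nu> = sets borel"
begin

lemma space_UNIV [simp]: "space \<nu> = UNIV"
  using sets_eq_imp_space_eq[OF sets_borel] by simp

lemma emeasure_window: "emeasure \<nu> {t..<t + \<delta>} = (\<integral>\<^sup>+x. in_window \<delta> t x \<partial>\<nu>)"
  by (simp add: in_window_eq_indicator)

lemma measurable_window [measurable]: "(\<lambda>t. emeasure \<nu> {t..<t + \<delta>}) \<in> borel_measurable borel"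
  unfolding emeasure_window by measurable

sublocale lb: pair_sigma_finite lborel \<nu>
  by (intro pair_sigma_finite.intro sigma_finite_lborel sigma_finite_measure_axioms)

text \<open>For \<open>x\<close> in \<open>U\<close> the windows of length \<open>1 / 2 ^ n\<close>
  containing \<open>x\<close> start in a set of length \<open>1 / 2 ^ n\<close>, which lies inside
  \<open>U\<close> once \<open>n\<close> is large. Fatou's lemma and Fubini do the rest. The bound
  serves both the projections and the distribution of slopes.\<close>

lemma emeasure_open_le_liminf:
  assumes "open U"
  shows "emeasure \<nu> U \<le> liminf (\<lambda>n. \<integral>\<^sup>+a. indicator U a * (2 ^ n * emeasure \<nu> {a..<a + 1 / 2 ^ n}) \<partial>lborel)"
proof -
  have [measurable]: "U \<in> sets borel" using assms by simp
  define h where "h = (\<lambda>n x. \<integral>\<^sup>+a. indicator U a * (2 ^ n * in_window (1 / 2 ^ n) a x) \<partial>lborel)"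
  have hm [measurable]: "h n \<in> borel_measurable borel" for n unfolding h_def by measurable
  have "emeasure \<nu> U = (\<integral>\<^sup>+x. indicator U x \<partial>\<nu>)" by simp
  also have "\<dots> \<le> (\<integral>\<^sup>+x. liminf (\<lambda>n. h n x) \<partial>\<nu>)"
  proof (intro nn_integral_mono)
    fix x
    show "indicator U x \<le> liminf (\<lambda>n. h n x)"
    proof (cases "x \<in> U")
      case True
      then obtain e where e: "e > 0" "ball x e \<subseteq> U" using assms open_contains_ball by blast
      have "(\<lambda>n. 1 / 2 ^ n :: real) \<longlonglongrightarrow> 0" by (rule LIMSEQ_divide_realpow_zero) simp
      then have "eventually (\<lambda>n. 1 / 2 ^ n < e) sequentially" by (rule order_tendstoD) (rule e)
      then have "eventually (\<lambda>n. 1 \<le> h n x) sequentially"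
      proof eventually_elim
        case (elim n)
        have "1 = (2 ^ n :: ennreal) * ennreal (1 / 2 ^ n)"
          by (simp add: ennreal_power flip: ennreal_numeral ennreal_mult)
        also have "ennreal (1 / 2 ^ n) = emeasure lborel {x - 1 / 2 ^ n<..x}" by simp
        also have "2 ^ n * \<dots> = (\<integral>\<^sup>+a. 2 ^ n * in_window (1 / 2 ^ n) a x \<partial>lborel)"
          by (subst nn_integral_cmult) (auto simp: in_window_eq_indicator(2))
        also have "\<dots> \<le> h n x" unfolding h_def
        proof (intro nn_integral_mono)
          fix a
          have "a \<in> U" if "a \<le> x" "x < a + 1 / 2 ^ n"
            using that elim e(2) by (intro subsetD[OF e(2)]) (auto simp: dist_real_def)
          then show "2 ^ n * in_window (1 / 2 ^ n) a x \<le> indicator U a * (2 ^ n * in_window (1 / 2 ^ n) a x)"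
            by (auto simp: in_window_def indicator_def)
        qed
        finally show ?case .
      qed
      then have "1 \<le> liminf (\<lambda>n. h n x)" by (rule Liminf_bounded)
      then show ?thesis using True by simp
    qed simp
  qed
  also have "\<dots> \<le> liminf (\<lambda>n. \<integral>\<^sup>+x. h n x \<partial>\<nu>)"
    by (rule nn_integral_liminf) simp
  also have "(\<lambda>n. \<integral>\<^sup>+x. h n x \<partial>\<nu>) = (\<lambda>n. \<integral>\<^sup>+a. indicator U a * (2 ^ n * emeasure \<nu> {a..<a + 1 / 2 ^ n}) \<partial>lborel)"
  proof
    fix n
    have "(\<integral>\<^sup>+x. h n x \<partial>\<nu>) = (\<integral>\<^sup>+a. \<integral>\<^sup>+x. indicator U a * (2 ^ n * in_window (1 / 2 ^ n) a x) \<partial>\<nu> \<partial>lborel)"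
      unfolding h_def by (rule lb.Fubini') measurable
    also have "\<dots> = (\<integral>\<^sup>+a. indicator U a * (2 ^ n * emeasure \<nu> {a..<a + 1 / 2 ^ n}) \<partial>lborel)"
      unfolding emeasure_window by (intro nn_integral_cong) (simp add: nn_integral_cmult)
    finally show "(\<integral>\<^sup>+x. h n x \<partial>\<nu>) = (\<integral>\<^sup>+a. indicator U a * (2 ^ n * emeasure \<nu> {a..<a + 1 / 2 ^ n}) \<partial>lborel)" .
  qed
  finally show ?thesis .
qed

text \<open>Split the window in two and use translation invariance. This yields the monotonicity in
  \<open>n\<close> that lets the supremum in \<open>L2_energy\<close> be exchanged with integration
  over slopes.\<close>

lemma window_energy_double:
  assumes "\<delta> > 0"
  shows "window_energy \<nu> (2 * \<delta>) \<le> 4 * window_energy \<nu> \<delta>"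
proof -
  define w where "w = (\<lambda>t. emeasure \<nu> {t..<t + \<delta>})"
  have [measurable]: "w \<in> borel_measurable borel" unfolding w_def by measurable
  have "window_energy \<nu> (2 * \<delta>) \<le> (\<integral>\<^sup>+t. 2 * (w t)^2 + 2 * (w (t + \<delta>))^2 \<partial>lborel)"
    unfolding window_energy_def
  proof (intro nn_integral_mono)
    fix t
    have "{t..<t + 2 * \<delta>} = {t..<t + \<delta>} \<union> {t + \<delta>..<t + \<delta> + \<delta>}" using assms by auto
    then have "emeasure \<nu> {t..<t + 2 * \<delta>} \<le> w t + w (t + \<delta>)"
      using emeasure_subadditive[of "{t..<t + \<delta>}" \<nu> "{t + \<delta>..<t + \<delta> + \<delta>}"] by (simp add: w_def)
    then have "(emeasure \<nu> {t..<t + 2 * \<delta>})^2 \<le> (w t + w (t + \<delta>))^2" by (rule power_mono) simp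
    also have "\<dots> \<le> 2 * (w t)^2 + 2 * (w (t + \<delta>))^2" by (rule ennreal_square_add_le)
    finally show "(emeasure \<nu> {t..<t + 2 * \<delta>})^2 \<le> 2 * (w t)^2 + 2 * (w (t + \<delta>))^2" .
  qed
  also have "\<dots> = 2 * window_energy \<nu> \<delta> + 2 * (\<integral>\<^sup>+t. (w (t + \<delta>))^2 \<partial>lborel)"
    unfolding window_energy_def by (simp add: nn_integral_add nn_integral_cmult) (simp add: w_def)
  also have "(\<integral>\<^sup>+t. (w (t + \<delta>))^2 \<partial>lborel) = (\<integral>\<^sup>+t. (w t)^2 \<partial>lborel)"
    using nn_integral_real_affine[of "\<lambda>t. (w t)^2" 1 \<delta>] by (simp add: add.commute)
  also have "\<dots> = window_energy \<nu> \<delta>"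
    by (simp add: window_energy_def w_def)
  also have "2 * window_energy \<nu> \<delta> + 2 * window_energy \<nu> \<delta> = 4 * window_energy \<nu> \<delta>"
    by (simp flip: distrib_right)
  finally show ?thesis .
qed

lemma incseq_window_energy: "incseq (\<lambda>n. 4 ^ n * window_energy \<nu> (1 / 2 ^ n))"
proof (rule incseq_SucI)
  fix n
  have "window_energy \<nu> (2 * (1 / 2 ^ Suc n)) \<le> 4 * window_energy \<nu> (1 / 2 ^ Suc n)"
    by (rule window_energy_double) simp
  then have "4 ^ n * window_energy \<nu> (1 / 2 ^ n) \<le> 4 ^ n * (4 * window_energy \<nu> (1 / 2 ^ Suc n))"
    by (intro mult_left_mono) simp_all
  then show "4 ^ n * window_energy \<nu> (1 / 2 ^ n) \<le> 4 ^ Suc n * window_energy \<nu> (1 / 2 ^ Suc n)"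
    by (simp add: mult_ac)
qed

lemma window_energy_Fubini:
  "window_energy \<nu> \<delta> = (\<integral>\<^sup>+x. \<integral>\<^sup>+y. \<integral>\<^sup>+t. in_window \<delta> t x * in_window \<delta> t y \<partial>lborel \<partial>\<nu> \<partial>\<nu>)"
proof -
  have "window_energy \<nu> \<delta> = (\<integral>\<^sup>+t. (\<integral>\<^sup>+x. in_window \<delta> t x \<partial>\<nu>) * (\<integral>\<^sup>+y. in_window \<delta> t y \<partial>\<nu>) \<partial>lborel)"
    unfolding window_energy_def emeasure_window power2_eq_square ..
  also have "\<dots> = (\<integral>\<^sup>+t. \<integral>\<^sup>+x. in_window \<delta> t x * (\<integral>\<^sup>+y. in_window \<delta> t y \<partial>\<nu>) \<partial>\<nu> \<partial>lborel)"
    by (intro nn_integral_cong nn_integral_multc[symmetric]) simp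
  also have "\<dots> = (\<integral>\<^sup>+x. \<integral>\<^sup>+t. in_window \<delta> t x * (\<integral>\<^sup>+y. in_window \<delta> t y \<partial>\<nu>) \<partial>lborel \<partial>\<nu>)"
    by (rule lb.Fubini'[symmetric]) measurable
  also have "\<dots> = (\<integral>\<^sup>+x. \<integral>\<^sup>+t. \<integral>\<^sup>+y. in_window \<delta> t x * in_window \<delta> t y \<partial>\<nu> \<partial>lborel \<partial>\<nu>)"
    by (intro nn_integral_cong nn_integral_cmult[symmetric]) simp
  also have "\<dots> = (\<integral>\<^sup>+x. \<integral>\<^sup>+y. \<integral>\<^sup>+t. in_window \<delta> t x * in_window \<delta> t y \<partial>lborel \<partial>\<nu> \<partial>\<nu>)"
    by (intro nn_integral_cong lb.Fubini'[symmetric]) measurable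
  finally show ?thesis .
qed

lemma emeasure_lborel_Ioc_diff: "\<delta> \<ge> 0 \<Longrightarrow> emeasure lborel {m - \<delta><..m} = ennreal \<delta>"
  by simp

text \<open>The overlap has length \<open>max 0 (\<delta> - \<bar>x - y\<bar>)\<close>. The two
  bounds below compare this kernel with the indicator of
  \<open>\<bar>x - y\<bar> \<le> \<delta>\<close>: from above for windows of length
  \<open>\<delta>\<close>, from below for length \<open>2 * \<delta>\<close>.\<close>

lemma window_overlap:
  "(\<integral>\<^sup>+t. in_window \<delta> t x * in_window \<delta> t y \<partial>lborel) = emeasure lborel ({x - \<delta><..x} \<inter> {y - \<delta><..y})"
  by (simp add: in_window_eq_indicator(2) flip: indicator_inter_arith)

lemma measurable_emeasure_near [measurable]:
  "(\<lambda>x. emeasure \<nu> {y. \<bar>x - y\<bar> \<le> \<delta>}) \<in> borel_measurable borel"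
proof -
  have "emeasure \<nu> {y. \<bar>x - y\<bar> \<le> \<delta>} = (\<integral>\<^sup>+y. (if \<bar>x - y\<bar> \<le> \<delta> then 1 else 0) \<partial>\<nu>)" for x
  proof -
    have "emeasure \<nu> {y. \<bar>x - y\<bar> \<le> \<delta>} = (\<integral>\<^sup>+y. indicator {y. \<bar>x - y\<bar> \<le> \<delta>} y \<partial>\<nu>)" by simp
    also have "\<dots> = (\<integral>\<^sup>+y. (if \<bar>x - y\<bar> \<le> \<delta> then 1 else 0) \<partial>\<nu>)"
      by (intro nn_integral_cong) (auto simp: indicator_def)
    finally show ?thesis .
  qed
  then show ?thesis by simp
qed

lemma window_energy_le:
  assumes "\<delta> > 0"
  shows "window_energy \<nu> \<delta> \<le> ennreal \<delta> * (\<integral>\<^sup>+x. emeasure \<nu> {y. \<bar>x - y\<bar> \<le> \<delta>} \<partial>\<nu>)"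
proof -
  have "window_energy \<nu> \<delta> \<le> (\<integral>\<^sup>+x. \<integral>\<^sup>+y. ennreal \<delta> * indicator {y. \<bar>x - y\<bar> \<le> \<delta>} y \<partial>\<nu> \<partial>\<nu>)"
    unfolding window_energy_Fubini window_overlap
  proof (intro nn_integral_mono)
    fix x y
    show "emeasure lborel ({x - \<delta><..x} \<inter> {y - \<delta><..y}) \<le> ennreal \<delta> * indicator {y. \<bar>x - y\<bar> \<le> \<delta>} y"
    proof (cases "\<bar>x - y\<bar> \<le> \<delta>")
      case True
      have "emeasure lborel ({x - \<delta><..x} \<inter> {y - \<delta><..y}) \<le> emeasure lborel {x - \<delta><..x}"
        by (rule emeasure_mono) auto
      also have "\<dots> = ennreal \<delta> * indicator {y. \<bar>x - y\<bar> \<le> \<delta>} y" using True assms by simp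
      finally show ?thesis .
    next
      case False
      then have "{x - \<delta><..x} \<inter> {y - \<delta><..y} = {}" by auto
      then show ?thesis by (simp only: emeasure_empty zero_le)
    qed
  qed
  also have "\<dots> = (\<integral>\<^sup>+x. ennreal \<delta> * emeasure \<nu> {y. \<bar>x - y\<bar> \<le> \<delta>} \<partial>\<nu>)"
    by (intro nn_integral_cong nn_integral_cmult_indicator) simp
  also have "\<dots> = ennreal \<delta> * (\<integral>\<^sup>+x. emeasure \<nu> {y. \<bar>x - y\<bar> \<le> \<delta>} \<partial>\<nu>)"
    by (rule nn_integral_cmult) measurable
  finally show ?thesis .
qed

lemma window_energy_ge:
  assumes "\<delta> > 0"
  shows "ennreal \<delta> * (\<integral>\<^sup>+x. emeasure \<nu> {y. \<bar>x - y\<bar> \<le> \<delta>} \<partial>\<nu>) \<le> window_energy \<nu> (2 * \<delta>)"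
proof -
  have "ennreal \<delta> * (\<integral>\<^sup>+x. emeasure \<nu> {y. \<bar>x - y\<bar> \<le> \<delta>} \<partial>\<nu>) = (\<integral>\<^sup>+x. ennreal \<delta> * emeasure \<nu> {y. \<bar>x - y\<bar> \<le> \<delta>} \<partial>\<nu>)"
    by (rule nn_integral_cmult[symmetric]) measurable
  also have "\<dots> = (\<integral>\<^sup>+x. \<integral>\<^sup>+y. ennreal \<delta> * indicator {y. \<bar>x - y\<bar> \<le> \<delta>} y \<partial>\<nu> \<partial>\<nu>)"
    by (intro nn_integral_cong nn_integral_cmult_indicator[symmetric]) simp
  also have "\<dots> \<le> window_energy \<nu> (2 * \<delta>)"
    unfolding window_energy_Fubini window_overlap
  proof (intro nn_integral_mono)
    fix x y
    show "ennreal \<delta> * indicator {y. \<bar>x - y\<bar> \<le> \<delta>} y \<le> emeasure lborel ({x - 2 * \<delta><..x} \<inter> {y - 2 * \<delta><..y})"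
    proof (cases "\<bar>x - y\<bar> \<le> \<delta>")
      case True
      have "ennreal \<delta> = emeasure lborel {min x y - \<delta><..min x y}" using assms by (simp only: emeasure_lborel_Ioc_diff less_imp_le)
      also have "\<dots> \<le> emeasure lborel ({x - 2 * \<delta><..x} \<inter> {y - 2 * \<delta><..y})"
        using True by (intro emeasure_mono) auto
      finally show ?thesis using True by simp
    qed simp
  qed
  finally show ?thesis .
qed

theorem null_of_L2_energy_finite:
  assumes fin: "L2_energy \<nu> < top" and N: "N \<in> null_sets lborel"
  shows "emeasure \<nu> N = 0"
proof -
  obtain s where s: "L2_energy \<nu> = ennreal s" "s \<ge> 0" using fin by (cases "L2_energy \<nu>") auto
  have Nb: "N \<in> sets borel" using N by (simp add: null_sets_def)
  have "emeasure \<nu> N \<le> 0 + ennreal e" if e: "e > 0" for e :: real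
  proof -
    \<comment> \<open>With \<open>U\<close> of length at most \<open>4 * \<tau> * \<tau>\<close>,
      the two terms of the square bound become \<open>\<tau> * s\<close> and \<open>\<tau>\<close>,
      whose sum is \<open>e\<close>.\<close>
    define \<tau> where "\<tau> = e / (s + 1)"
    have \<tau>: "\<tau> > 0" using e s by (simp add: \<tau>_def)
    obtain U where U: "open U" "N \<subseteq> U" "emeasure lborel (U - N) < ennreal (4 * \<tau> * \<tau>)"
      using outer_regular_lborel[OF Nb, of "4 * \<tau> * \<tau>"] \<tau> by auto
    have Ub [measurable]: "U \<in> sets borel" using U by simp
    have lU: "emeasure lborel U \<le> ennreal (4 * \<tau> * \<tau>)"
      using U(3) emeasure_Diff_null_set[OF N, of U] Ub by simp
    have bound: "(\<integral>\<^sup>+a. indicator U a * (2 ^ n * emeasure \<nu> {a..<a + 1 / 2 ^ n}) \<partial>lborel) \<le> ennreal e" for n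
    proof -
      let ?y = "\<lambda>a. 2 ^ n * emeasure \<nu> {a..<a + 1 / 2 ^ n}"
      have "(\<integral>\<^sup>+a. indicator U a * ?y a \<partial>lborel) \<le>
          (\<integral>\<^sup>+a. ennreal \<tau> * (4 ^ n * (emeasure \<nu> {a..<a + 1 / 2 ^ n})^2) + ennreal (1 / (4 * \<tau>)) * indicator U a \<partial>lborel)"
      proof (intro nn_integral_mono)
        fix a
        have "(?y a)^2 = 4 ^ n * (emeasure \<nu> {a..<a + 1 / 2 ^ n})^2"
          by (simp add: power_mult_distrib) (simp add: power2_eq_square flip: power_mult_distrib)
        then have "?y a \<le> ennreal \<tau> * (4 ^ n * (emeasure \<nu> {a..<a + 1 / 2 ^ n})^2) + ennreal (1 / (4 * \<tau>))"
          using ennreal_le_square_bound[OF \<tau>, of "?y a"] by simp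
        then show "indicator U a * ?y a \<le> ennreal \<tau> * (4 ^ n * (emeasure \<nu> {a..<a + 1 / 2 ^ n})^2) + ennreal (1 / (4 * \<tau>)) * indicator U a"
          by (cases "a \<in> U") auto
      qed
      also have "\<dots> = ennreal \<tau> * (4 ^ n * window_energy \<nu> (1 / 2 ^ n)) + ennreal (1 / (4 * \<tau>)) * emeasure lborel U"
        unfolding window_energy_def by (simp add: nn_integral_add nn_integral_cmult)
      also have "\<dots> \<le> ennreal \<tau> * L2_energy \<nu> + ennreal (1 / (4 * \<tau>)) * ennreal (4 * \<tau> * \<tau>)"
        unfolding L2_energy_def by (intro add_mono mult_left_mono SUP_upper lU) auto
      also have "\<dots> = ennreal (\<tau> * s + \<tau>)"
        using \<tau> s by (simp add: ennreal_plus del: ennreal_plus[symmetric] flip: ennreal_mult)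
      also have "\<tau> * s + \<tau> = \<tau> * (s + 1)" by (simp add: distrib_left)
      also have "\<dots> = e" using s by (simp add: \<tau>_def)
      finally show ?thesis .
    qed
    have "emeasure \<nu> N \<le> emeasure \<nu> U" using U by (intro emeasure_mono) auto
    also have "\<dots> \<le> liminf (\<lambda>n. \<integral>\<^sup>+a. indicator U a * (2 ^ n * emeasure \<nu> {a..<a + 1 / 2 ^ n}) \<partial>lborel)"
      by (rule emeasure_open_le_liminf[OF U(1)])
    also have "\<dots> \<le> liminf (\<lambda>n::nat. ennreal e)"
      by (intro Liminf_mono always_eventually allI bound)
    also have "\<dots> = ennreal e" by (simp add: Liminf_const)
    finally show ?thesis by simp
  qed
  then have "emeasure \<nu> N \<le> 0" by (rule ennreal_le_epsilon)
  then show ?thesis by simp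
qed

end

section \<open>Projections and slopes\<close>

text \<open>Projection along lines of slope \<open>a\<close>, up to a scalar factor. It is affine in
  \<open>a\<close>, so Lebesgue measure on slopes is the natural measure on directions; the vertical
  direction is left out.\<close>

definition shear :: "real \<Rightarrow> real^2 \<Rightarrow> real" where
  "shear a x = x $ 2 - a * x $ 1"

text \<open>For equal first coordinates the division by zero gives 0; such pairs are excluded
  wherever the slope carries information.\<close>

definition slope :: "real^2 \<Rightarrow> real^2 \<Rightarrow> real" where
  "slope x y = (x $ 2 - y $ 2) / (x $ 1 - y $ 1)"

lemma measurable_vec_nth_compose [measurable (raw)]:
  fixes f :: "'a \<Rightarrow> real^2"
  assumes "f \<in> borel_measurable M"
  shows "(\<lambda>x. f x $ i) \<in> borel_measurable M"
  by (rule measurable_compose[OF assms]) (intro borel_measurable_continuous_onI continuous_intros)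

lemma measurable_shear [measurable (raw)]:
  assumes [measurable]: "f \<in> borel_measurable M" "g \<in> borel_measurable M"
  shows "(\<lambda>x. shear (f x) (g x)) \<in> borel_measurable M"
  unfolding shear_def by measurable

lemma measurable_slope [measurable (raw)]:
  assumes [measurable]: "f \<in> borel_measurable M" "g \<in> borel_measurable M"
  shows "(\<lambda>x. slope (f x) (g x)) \<in> borel_measurable M"
  unfolding slope_def by measurable

lemma near_directions_cases:
  fixes p q d R \<delta> :: real
  assumes "R \<ge> 1" "\<delta> > 0" "d > 0" "d \<le> \<bar>p\<bar> + \<bar>q\<bar>"
  shows "emeasure lborel ({-R..R} \<inter> {a. \<bar>q - a * p\<bar> \<le> \<delta>}) \<le> ennreal ((8 * R + 4) * \<delta> / d)"
proof (cases "\<bar>q\<bar> \<le> 2 * R * \<bar>p\<bar>")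
  case True
  then have p: "\<bar>p\<bar> > 0" "d \<le> (2 * R + 1) * \<bar>p\<bar>" using assms by (auto simp: algebra_simps)
  have "{-R..R} \<inter> {a. \<bar>q - a * p\<bar> \<le> \<delta>} \<subseteq> {q / p - \<delta> / \<bar>p\<bar>..q / p + \<delta> / \<bar>p\<bar>}"
  proof
    fix a assume a: "a \<in> {-R..R} \<inter> {a. \<bar>q - a * p\<bar> \<le> \<delta>}"
    have "\<bar>q / p - a\<bar> * \<bar>p\<bar> = \<bar>q - a * p\<bar>" using p by (simp flip: abs_mult add: left_diff_distrib)
    then have "\<bar>q / p - a\<bar> \<le> \<delta> / \<bar>p\<bar>" using a p by (simp add: pos_le_divide_eq)
    then show "a \<in> {q / p - \<delta> / \<bar>p\<bar>..q / p + \<delta> / \<bar>p\<bar>}" unfolding atLeastAtMost_iff by linarith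
  qed
  then have "emeasure lborel ({-R..R} \<inter> {a. \<bar>q - a * p\<bar> \<le> \<delta>}) \<le> emeasure lborel {q / p - \<delta> / \<bar>p\<bar>..q / p + \<delta> / \<bar>p\<bar>}"
    by (rule emeasure_mono) simp
  also have "\<dots> = ennreal (2 * \<delta> / \<bar>p\<bar>)" using assms by (simp add: field_simps)
  also have "\<dots> \<le> ennreal ((8 * R + 4) * \<delta> / d)"
  proof (rule ennreal_leI)
    have "2 * \<delta> * d \<le> 2 * \<delta> * ((2 * R + 1) * \<bar>p\<bar>)" using p assms by (intro mult_left_mono) auto
    also have "\<dots> \<le> (8 * R + 4) * \<delta> * \<bar>p\<bar>" using assms by (simp add: algebra_simps)
    finally show "2 * \<delta> / \<bar>p\<bar> \<le> (8 * R + 4) * \<delta> / d" using p assms by (simp add: divide_simps mult.commute)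
  qed
  finally show ?thesis .
next
  case False
  have pq: "\<bar>p\<bar> \<le> \<bar>q\<bar>"
  proof -
    have "1 * \<bar>p\<bar> \<le> (2 * R) * \<bar>p\<bar>" using assms by (intro mult_right_mono) auto
    then show ?thesis using False by simp
  qed
  show ?thesis
  proof (cases "\<bar>q\<bar> \<le> 2 * \<delta>")
    case True
    have "emeasure lborel ({-R..R} \<inter> {a. \<bar>q - a * p\<bar> \<le> \<delta>}) \<le> emeasure lborel {-R..R}"
      by (rule emeasure_mono) auto
    also have "\<dots> = ennreal (2 * R)" using assms by simp
    also have "\<dots> \<le> ennreal ((8 * R + 4) * \<delta> / d)"
    proof (rule ennreal_leI)
      have "d \<le> 4 * \<delta>" using assms pq True by linarith
      then have "2 * R * d \<le> 2 * R * (4 * \<delta>)" using assms by (intro mult_left_mono) auto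
      also have "\<dots> \<le> (8 * R + 4) * \<delta>" using assms by (simp add: algebra_simps)
      finally show "2 * R \<le> (8 * R + 4) * \<delta> / d" using assms by (simp add: pos_le_divide_eq)
    qed
    finally show ?thesis .
  next
    case far: False
    have "\<not> \<bar>q - a * p\<bar> \<le> \<delta>" if "a \<in> {-R..R}" for a
    proof -
      have "\<bar>a * p\<bar> \<le> R * \<bar>p\<bar>" unfolding abs_mult using that by (intro mult_right_mono) auto
      then show ?thesis using False far by linarith
    qed
    then have "{-R..R} \<inter> {a. \<bar>q - a * p\<bar> \<le> \<delta>} = {}" by auto
    then show ?thesis by (simp only: emeasure_empty zero_le)
  qed
qed

lemma near_directions_le:
  assumes "R \<ge> 1" "\<delta> > 0"
  shows "emeasure lborel ({-R..R} \<inter> {a. \<bar>shear a x - shear a y\<bar> \<le> \<delta>})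
    \<le> ennreal ((8 * R + 4) * \<delta>) * inverse (ennreal (dist x y))"
proof (cases "dist x y > 0")
  case True
  have eq: "shear a x - shear a y = (x $ 2 - y $ 2) - a * (x $ 1 - y $ 1)" for a
    by (simp add: shear_def algebra_simps)
  have "ennreal ((8 * R + 4) * \<delta> / dist x y) = ennreal ((8 * R + 4) * \<delta>) * inverse (ennreal (dist x y))"
    using True assms by (simp add: inverse_ennreal divide_inverse flip: ennreal_mult)
  then show ?thesis
    unfolding eq using near_directions_cases[OF assms True dist_le_coordinates] by simp
next
  case False
  \<comment> \<open>On the diagonal \<open>inverse 0 = top\<close> in \<open>ennreal\<close>, so the
    bound is trivial there.\<close>
  then have "inverse (ennreal (dist x y)) = top" by simp
  then show ?thesis using assms by (simp add: ennreal_mult_top)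
qed

section \<open>Averaging the projection energies over slopes\<close>

locale planar_measure = finite_measure \<mu> for \<mu> :: "(real^2) measure" +
  assumes sets_borel [measurable_cong, simp]: "sets \<mu> = sets borel"
begin

lemma space_UNIV [simp]: "space \<mu> = UNIV"
  using sets_eq_imp_space_eq[OF sets_borel] by simp

sublocale lb: pair_sigma_finite lborel \<mu>
  by (intro pair_sigma_finite.intro sigma_finite_lborel sigma_finite_measure_axioms)

sublocale pp: pair_sigma_finite \<mu> \<mu>
  by (intro pair_sigma_finite.intro sigma_finite_measure_axioms)

definition sheared :: "real \<Rightarrow> real measure" where
  "sheared a = distr \<mu> borel (shear a)"

lemma shear_borel [measurable]: "shear a \<in> borel_measurable borel"
proof -
  have "(\<lambda>x. shear a x) \<in> borel_measurable borel" by measurable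
  then show ?thesis by simp
qed

sublocale sheared: finite_real_measure "sheared a" for a
proof (intro finite_real_measure.intro finite_measureI finite_real_measure_axioms.intro)
  show "emeasure (sheared a) (space (sheared a)) \<noteq> \<infinity>"
    by (simp add: sheared_def emeasure_distr)
qed (simp add: sheared_def)

lemma emeasure_sheared: "A \<in> sets borel \<Longrightarrow> emeasure (sheared a) A = emeasure \<mu> (shear a -` A)"
  by (simp add: sheared_def emeasure_distr)

lemma emeasure_sheared_window: "emeasure (sheared a) {t..<t + \<delta>} = (\<integral>\<^sup>+x. in_window \<delta> t (shear a x) \<partial>\<mu>)"
  unfolding sheared.emeasure_window unfolding sheared_def by (subst nn_integral_distr) measurable

lemma measurable_window_energy_sheared [measurable]:
  "(\<lambda>a. window_energy (sheared a) \<delta>) \<in> borel_measurable borel"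
  unfolding window_energy_def emeasure_sheared_window by measurable

lemma measurable_L2_energy_sheared [measurable]:
  "(\<lambda>a. L2_energy (sheared a)) \<in> borel_measurable borel"
  unfolding L2_energy_def by measurable

definition near :: "real \<Rightarrow> real \<Rightarrow> real^2 \<Rightarrow> real^2 \<Rightarrow> ennreal" where
  "near \<delta> a x y = (if \<bar>shear a x - shear a y\<bar> \<le> \<delta> then 1 else 0)"

lemma measurable_near [measurable (raw)]:
  assumes [measurable]: "f \<in> borel_measurable M" "g \<in> borel_measurable M" "h \<in> borel_measurable M"
  shows "(\<lambda>x. near \<delta> (f x) (g x) (h x)) \<in> borel_measurable M"
  unfolding near_def by measurable

lemma near_pairs_sheared:
  "(\<integral>\<^sup>+s. emeasure (sheared a) {t. \<bar>s - t\<bar> \<le> \<delta>} \<partial>sheared a) = (\<integral>\<^sup>+x. \<integral>\<^sup>+y. near \<delta> a x y \<partial>\<mu> \<partial>\<mu>)"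
proof -
  have "emeasure (sheared a) {t. \<bar>s - t\<bar> \<le> \<delta>} = (\<integral>\<^sup>+y. (if \<bar>s - shear a y\<bar> \<le> \<delta> then 1 else 0) \<partial>\<mu>)" for s
  proof -
    have m: "shear a -` {t. \<bar>s - t\<bar> \<le> \<delta>} \<in> sets \<mu>"
      using measurable_sets[OF shear_borel, of "{t. \<bar>s - t\<bar> \<le> \<delta>}" a] by simp
    have "emeasure (sheared a) {t. \<bar>s - t\<bar> \<le> \<delta>} = (\<integral>\<^sup>+y. indicator (shear a -` {t. \<bar>s - t\<bar> \<le> \<delta>}) y \<partial>\<mu>)"
      by (subst emeasure_sheared) (use m in simp_all)
    also have "\<dots> = (\<integral>\<^sup>+y. (if \<bar>s - shear a y\<bar> \<le> \<delta> then 1 else 0) \<partial>\<mu>)"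
      by (intro nn_integral_cong) (auto simp: indicator_def)
    finally show ?thesis .
  qed
  then show ?thesis
    unfolding near_def unfolding sheared_def
    by (subst nn_integral_distr) simp_all
qed

definition riesz_energy :: ennreal where
  "riesz_energy = (\<integral>\<^sup>+x. \<integral>\<^sup>+y. inverse (ennreal (dist x y)) \<partial>\<mu> \<partial>\<mu>)"

text \<open>At scale \<open>\<delta> = 1 / 2 ^ n\<close> the normalised energy is at most
  \<open>2 ^ n\<close> times the mass of the pairs whose projections are
  \<open>\<delta>\<close>-close. With the slope integrated first, transversality gives a multiple of
  \<open>\<delta> / dist x y\<close>, and \<open>2 ^ n * \<delta> = 1\<close> makes the bound
  independent of \<open>n\<close>.\<close>

lemma integral_L2_energy_le:
  assumes R: "R \<ge> 1"
  shows "(\<integral>\<^sup>+a. indicator {-R..R} a * L2_energy (sheared a) \<partial>lborel) \<le> ennreal (8 * R + 4) * riesz_energy"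
proof -
  have "(\<integral>\<^sup>+a. indicator {-R..R} a * L2_energy (sheared a) \<partial>lborel) =
      (\<integral>\<^sup>+a. (SUP n. indicator {-R..R} a * (4 ^ n * window_energy (sheared a) (1 / 2 ^ n))) \<partial>lborel)"
    unfolding L2_energy_def by (simp add: SUP_mult_left_ennreal)
  also have "\<dots> = (SUP n. \<integral>\<^sup>+a. indicator {-R..R} a * (4 ^ n * window_energy (sheared a) (1 / 2 ^ n)) \<partial>lborel)"
    by (rule nn_integral_monotone_convergence_SUP)
       (auto simp: incseq_def le_fun_def intro!: mult_left_mono incseqD[OF sheared.incseq_window_energy])
  also have "\<dots> \<le> ennreal (8 * R + 4) * riesz_energy"
  proof (rule SUP_least)
    fix n
    define \<delta> where "\<delta> = (1 / 2 ^ n :: real)"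
    have \<delta>: "\<delta> > 0" by (simp add: \<delta>_def)
    have pow: "4 ^ n * (ennreal \<delta> * z) = 2 ^ n * z" for z
    proof -
      have "(4 ^ n :: ennreal) * ennreal \<delta> = 2 ^ n"
        by (simp add: \<delta>_def ennreal_power power_divide flip: ennreal_numeral ennreal_mult power_mult_distrib)
           (simp flip: power_divide)
      then show ?thesis by (simp flip: mult.assoc)
    qed
    have "(\<integral>\<^sup>+a. indicator {-R..R} a * (4 ^ n * window_energy (sheared a) \<delta>) \<partial>lborel) \<le>
      (\<integral>\<^sup>+a. indicator {-R..R} a * (2 ^ n * (\<integral>\<^sup>+x. \<integral>\<^sup>+y. near \<delta> a x y \<partial>\<mu> \<partial>\<mu>)) \<partial>lborel)"
    proof (intro nn_integral_mono mult_left_mono)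
      fix a
      have "4 ^ n * window_energy (sheared a) \<delta> \<le> 4 ^ n * (ennreal \<delta> * (\<integral>\<^sup>+x. \<integral>\<^sup>+y. near \<delta> a x y \<partial>\<mu> \<partial>\<mu>))"
        using sheared.window_energy_le[OF \<delta>, of a] unfolding near_pairs_sheared by (intro mult_left_mono) auto
      then show "4 ^ n * window_energy (sheared a) \<delta> \<le> 2 ^ n * (\<integral>\<^sup>+x. \<integral>\<^sup>+y. near \<delta> a x y \<partial>\<mu> \<partial>\<mu>)"
        unfolding pow .
    qed simp
    also have "\<dots> = (\<integral>\<^sup>+a. \<integral>\<^sup>+x. \<integral>\<^sup>+y. indicator {-R..R} a * (2 ^ n * near \<delta> a x y) \<partial>\<mu> \<partial>\<mu> \<partial>lborel)"
      by (simp add: nn_integral_cmult)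
    also have "\<dots> = (\<integral>\<^sup>+x. \<integral>\<^sup>+a. \<integral>\<^sup>+y. indicator {-R..R} a * (2 ^ n * near \<delta> a x y) \<partial>\<mu> \<partial>lborel \<partial>\<mu>)"
      by (rule lb.Fubini'[symmetric]) measurable
    also have "\<dots> = (\<integral>\<^sup>+x. \<integral>\<^sup>+y. \<integral>\<^sup>+a. indicator {-R..R} a * (2 ^ n * near \<delta> a x y) \<partial>lborel \<partial>\<mu> \<partial>\<mu>)"
      by (intro nn_integral_cong lb.Fubini'[symmetric]) measurable
    also have "\<dots> \<le> (\<integral>\<^sup>+x. \<integral>\<^sup>+y. ennreal (8 * R + 4) * inverse (ennreal (dist x y)) \<partial>\<mu> \<partial>\<mu>)"
    proof (intro nn_integral_mono)
      fix x y
      have [measurable]: "{a. \<bar>shear a x - shear a y\<bar> \<le> \<delta>} \<in> sets borel"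
        by measurable
      have "(\<integral>\<^sup>+a. indicator {-R..R} a * (2 ^ n * near \<delta> a x y) \<partial>lborel) =
          (\<integral>\<^sup>+a. 2 ^ n * indicator ({-R..R} \<inter> {a. \<bar>shear a x - shear a y\<bar> \<le> \<delta>}) a \<partial>lborel)"
        by (intro nn_integral_cong) (auto simp: near_def indicator_def)
      also have "\<dots> = 2 ^ n * emeasure lborel ({-R..R} \<inter> {a. \<bar>shear a x - shear a y\<bar> \<le> \<delta>})"
        by (rule nn_integral_cmult_indicator) simp
      also have "\<dots> \<le> 2 ^ n * (ennreal ((8 * R + 4) * \<delta>) * inverse (ennreal (dist x y)))"
        by (intro mult_left_mono near_directions_le R \<delta>) simp
      also have "2 ^ n * (ennreal ((8 * R + 4) * \<delta>) * inverse (ennreal (dist x y))) = ennreal (8 * R + 4) * inverse (ennreal (dist x y))"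
      proof -
        have "(2 ^ n :: ennreal) * ennreal ((8 * R + 4) * \<delta>) = ennreal (2 ^ n * ((8 * R + 4) * \<delta>))"
          using R \<delta> by (simp add: ennreal_mult flip: ennreal_power)
        also have "2 ^ n * ((8 * R + 4) * \<delta>) = 8 * R + 4" by (simp add: \<delta>_def)
        finally show ?thesis by (simp flip: mult.assoc)
      qed
      finally show "(\<integral>\<^sup>+a. indicator {-R..R} a * (2 ^ n * near \<delta> a x y) \<partial>lborel) \<le> ennreal (8 * R + 4) * inverse (ennreal (dist x y))" .
    qed
    also have "\<dots> = ennreal (8 * R + 4) * riesz_energy"
      unfolding riesz_energy_def by (simp add: nn_integral_cmult)
    finally show "(\<integral>\<^sup>+a. indicator {-R..R} a * (4 ^ n * window_energy (sheared a) (1 / 2 ^ n)) \<partial>lborel) \<le> ennreal (8 * R + 4) * riesz_energy"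
      unfolding \<delta>_def .
  qed
  finally show ?thesis .
qed

section \<open>The distribution of the slopes of pairs\<close>

definition slab_pairs :: "nat \<Rightarrow> ((real^2) \<times> (real^2)) set" where
  "slab_pairs m = {(x, y). x $ 1 \<noteq> y $ 1 \<and> \<bar>x $ 1 - y $ 1\<bar> \<le> 2 ^ m}"

text \<open>The cut-off by \<open>slab_pairs m\<close> makes closeness of slopes imply closeness of
  projections with constant \<open>2 ^ m\<close>. The locale assumes no bounded support, so all
  pairs that are not vertical are exhausted by letting \<open>m\<close> run through the
  naturals.\<close>

definition slope_measure :: "nat \<Rightarrow> real measure" where
  "slope_measure m = distr (density (\<mu> \<Otimes>\<^sub>M \<mu>) (indicator (slab_pairs m))) borel (\<lambda>(x, y). slope x y)"

lemma measurable_pair_predicate: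
  assumes "Measurable.pred (borel \<Otimes>\<^sub>M borel) (\<lambda>(x, y). P x y)"
  shows "{(x, y). P x y} \<in> sets (\<mu> \<Otimes>\<^sub>M \<mu>)"
proof -
  have "sets (\<mu> \<Otimes>\<^sub>M \<mu>) = sets (borel \<Otimes>\<^sub>M borel)" by (rule sets_pair_measure_cong) simp_all
  then show ?thesis using assms unfolding pred_def by (simp add: space_pair_measure)
qed

lemma slab_pairs_sets [measurable]: "slab_pairs m \<in> sets (\<mu> \<Otimes>\<^sub>M \<mu>)"
  unfolding slab_pairs_def by (rule measurable_pair_predicate) measurable

lemma emeasure_slope_measure:
  assumes [measurable]: "A \<in> sets borel"
  shows "emeasure (slope_measure m) A = emeasure (\<mu> \<Otimes>\<^sub>M \<mu>) {(x, y). (x, y) \<in> slab_pairs m \<and> slope x y \<in> A}"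
proof -
  have ms: "{(x, y). slope x y \<in> A} \<in> sets (\<mu> \<Otimes>\<^sub>M \<mu>)"
    by (rule measurable_pair_predicate) measurable
  have "emeasure (slope_measure m) A = emeasure (density (\<mu> \<Otimes>\<^sub>M \<mu>) (indicator (slab_pairs m))) {(x, y). slope x y \<in> A}"
    unfolding slope_measure_def
    by (subst emeasure_distr) (auto simp: space_pair_measure intro!: arg_cong2[where f = emeasure])
  also have "\<dots> = (\<integral>\<^sup>+p. indicator (slab_pairs m) p * indicator {(x, y). slope x y \<in> A} p \<partial>(\<mu> \<Otimes>\<^sub>M \<mu>))"
    by (rule emeasure_density) (use ms in auto)
  also have "\<dots> = (\<integral>\<^sup>+p. indicator (slab_pairs m \<inter> {(x, y). slope x y \<in> A}) p \<partial>(\<mu> \<Otimes>\<^sub>M \<mu>))"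
    by (simp add: indicator_inter_arith)
  also have "\<dots> = emeasure (\<mu> \<Otimes>\<^sub>M \<mu>) (slab_pairs m \<inter> {(x, y). slope x y \<in> A})"
    by (rule nn_integral_indicator) (intro sets.Int slab_pairs_sets ms)
  also have "slab_pairs m \<inter> {(x, y). slope x y \<in> A} = {(x, y). (x, y) \<in> slab_pairs m \<and> slope x y \<in> A}" by auto
  finally show ?thesis .
qed

sublocale slope_measure: finite_real_measure "slope_measure m" for m
proof (intro finite_real_measure.intro finite_measureI finite_real_measure_axioms.intro)
  have sp: "space (slope_measure m) = UNIV" by (simp add: slope_measure_def)
  have "finite_measure (\<mu> \<Otimes>\<^sub>M \<mu>)"
    by (rule finite_measure_pair_measure) unfold_locales
  then show "emeasure (slope_measure m) (space (slope_measure m)) \<noteq> \<infinity>"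
    unfolding sp by (subst emeasure_slope_measure) (auto simp: finite_measure.emeasure_finite)
qed (simp add: slope_measure_def)

lemma near_pairs_emeasure:
  "emeasure (\<mu> \<Otimes>\<^sub>M \<mu>) {(x, y). \<bar>shear a x - shear a y\<bar> \<le> \<delta>} = (\<integral>\<^sup>+x. \<integral>\<^sup>+y. near \<delta> a x y \<partial>\<mu> \<partial>\<mu>)"
proof -
  have "emeasure (\<mu> \<Otimes>\<^sub>M \<mu>) {(x, y). \<bar>shear a x - shear a y\<bar> \<le> \<delta>} =
     (\<integral>\<^sup>+x. \<integral>\<^sup>+y. indicator {(x, y). \<bar>shear a x - shear a y\<bar> \<le> \<delta>} (x, y) \<partial>\<mu> \<partial>\<mu>)"
    by (rule emeasure_pair_measure) (rule measurable_pair_predicate, measurable)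
  also have "\<dots> = (\<integral>\<^sup>+x. \<integral>\<^sup>+y. near \<delta> a x y \<partial>\<mu> \<partial>\<mu>)"
    by (intro nn_integral_cong) (auto simp: near_def indicator_def)
  finally show ?thesis .
qed

text \<open>
  If \<open>slope x y\<close> lies within \<open>h\<close> of \<open>a\<close> and \<open>\<bar>x $ 1 - y $ 1\<bar> \<le> 2\<^sup>m\<close>, then the images of \<open>x\<close> and
  \<open>y\<close> under the projection \<open>shear a\<close> differ by at most \<open>2\<^sup>m h\<close>. Hence the density of the slopes is
  controlled pointwise by the energy of the projections, whose integral is finite.
\<close>

lemma slope_measure_window_le:
  assumes n: "n \<ge> m + 1"
  shows "2 ^ n * emeasure (slope_measure m) {a..<a + 1 / 2 ^ n} \<le> 2 ^ (m + 2) * L2_energy (sheared a)"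
proof -
  \<comment> \<open>Here \<open>\<delta>\<close> equals \<open>2 ^ m / 2 ^ n\<close>. Since
    \<open>window_energy_ge\<close> passes to windows of length \<open>2 * \<delta>\<close>, one
    more halving is spent to reach \<open>1 / 2 ^ k\<close>, a scale occurring in
    \<open>L2_energy\<close>.\<close>
  define k where "k = n - m - 1"
  define \<delta> where "\<delta> = (1 / 2 ^ (k + 1) :: real)"
  have \<delta>: "\<delta> > 0" by (simp add: \<delta>_def)
  have nk: "n = m + k + 1" using n by (simp add: k_def)
  have sub: "{(x, y). (x, y) \<in> slab_pairs m \<and> slope x y \<in> {a..<a + 1 / 2 ^ n}} \<subseteq> {(x, y). \<bar>shear a x - shear a y\<bar> \<le> \<delta>}"
  proof safe
    fix x y assume xy: "(x, y) \<in> slab_pairs m" "slope x y \<in> {a..<a + 1 / 2 ^ n}"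
    have ne: "x $ 1 - y $ 1 \<noteq> 0" and le: "\<bar>x $ 1 - y $ 1\<bar> \<le> 2 ^ m" using xy by (auto simp: slab_pairs_def)
    have "slope x y * (x $ 1 - y $ 1) = x $ 2 - y $ 2" using ne by (simp add: slope_def)
    then have "shear a x - shear a y = (slope x y - a) * (x $ 1 - y $ 1)"
      by (simp add: shear_def algebra_simps)
    then have "\<bar>shear a x - shear a y\<bar> = \<bar>slope x y - a\<bar> * \<bar>x $ 1 - y $ 1\<bar>" by (simp add: abs_mult)
    also have "\<dots> \<le> (1 / 2 ^ n) * 2 ^ m" using xy(2) le by (intro mult_mono) auto
    also have "\<dots> = \<delta>" by (simp add: \<delta>_def nk power_add)
    finally show "\<bar>shear a x - shear a y\<bar> \<le> \<delta>" .
  qed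
  have "emeasure (slope_measure m) {a..<a + 1 / 2 ^ n} \<le> (\<integral>\<^sup>+x. \<integral>\<^sup>+y. near \<delta> a x y \<partial>\<mu> \<partial>\<mu>)"
  proof -
    have meas: "{(x, y). \<bar>shear a x - shear a y\<bar> \<le> \<delta>} \<in> sets (\<mu> \<Otimes>\<^sub>M \<mu>)"
      by (rule measurable_pair_predicate) measurable
    have "emeasure (slope_measure m) {a..<a + 1 / 2 ^ n} = emeasure (\<mu> \<Otimes>\<^sub>M \<mu>) {(x, y). (x, y) \<in> slab_pairs m \<and> slope x y \<in> {a..<a + 1 / 2 ^ n}}"
      by (rule emeasure_slope_measure) simp
    then show ?thesis unfolding near_pairs_emeasure[symmetric] using emeasure_mono[OF sub meas] by (simp only:)
  qed
  then have "2 ^ n * emeasure (slope_measure m) {a..<a + 1 / 2 ^ n} \<le> 2 ^ n * (\<integral>\<^sup>+x. \<integral>\<^sup>+y. near \<delta> a x y \<partial>\<mu> \<partial>\<mu>)"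
    by (intro mult_left_mono) auto
  also have "2 ^ n * (\<integral>\<^sup>+x. \<integral>\<^sup>+y. near \<delta> a x y \<partial>\<mu> \<partial>\<mu>)
      = 2 ^ (m + 2) * (4 ^ k * (ennreal \<delta> * (\<integral>\<^sup>+x. \<integral>\<^sup>+y. near \<delta> a x y \<partial>\<mu> \<partial>\<mu>)))"
  proof -
    have "2 ^ n = 2 ^ (m + 2) * (4 ^ k * \<delta>)"
      by (simp add: \<delta>_def nk power_add field_simps flip: power_mult_distrib)
    then have "ennreal (2 ^ n) = ennreal (2 ^ (m + 2) * (4 ^ k * \<delta>))" by simp
    then have "(2 ^ n :: ennreal) = 2 ^ (m + 2) * (4 ^ k * ennreal \<delta>)"
      using \<delta> by (simp add: ennreal_mult flip: ennreal_power)
    then show ?thesis by (simp add: mult.assoc)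
  qed
  also have "\<dots> \<le> 2 ^ (m + 2) * (4 ^ k * window_energy (sheared a) (2 * \<delta>))"
    using sheared.window_energy_ge[OF \<delta>, of a] unfolding near_pairs_sheared by (intro mult_left_mono) auto
  also have "2 * \<delta> = 1 / 2 ^ k" by (simp add: \<delta>_def)
  also have "4 ^ k * window_energy (sheared a) (1 / 2 ^ k) \<le> L2_energy (sheared a)"
    unfolding L2_energy_def by (rule SUP_upper) simp
  finally show ?thesis by (simp only: mult_left_mono zero_le)
qed

lemma slope_measure_open_le:
  assumes U: "open U"
  shows "emeasure (slope_measure m) U \<le> 2 ^ (m + 2) * (\<integral>\<^sup>+a. indicator U a * L2_energy (sheared a) \<partial>lborel)"
proof -
  have [measurable]: "U \<in> sets borel" using U by simp
  let ?B = "2 ^ (m + 2) * (\<integral>\<^sup>+a. indicator U a * L2_energy (sheared a) \<partial>lborel)"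
  have "(\<integral>\<^sup>+a. indicator U a * (2 ^ n * emeasure (slope_measure m) {a..<a + 1 / 2 ^ n}) \<partial>lborel) \<le> ?B"
    if "n \<ge> m + 1" for n
  proof -
    have "(\<integral>\<^sup>+a. indicator U a * (2 ^ n * emeasure (slope_measure m) {a..<a + 1 / 2 ^ n}) \<partial>lborel)
      \<le> (\<integral>\<^sup>+a. indicator U a * (2 ^ (m + 2) * L2_energy (sheared a)) \<partial>lborel)"
      by (intro nn_integral_mono mult_left_mono slope_measure_window_le that) simp
    also have "\<dots> = (\<integral>\<^sup>+a. 2 ^ (m + 2) * (indicator U a * L2_energy (sheared a)) \<partial>lborel)"
      by (simp add: mult_ac)
    also have "\<dots> = ?B" by (rule nn_integral_cmult) measurable
    finally show ?thesis .
  qed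
  then have "liminf (\<lambda>n. \<integral>\<^sup>+a. indicator U a * (2 ^ n * emeasure (slope_measure m) {a..<a + 1 / 2 ^ n}) \<partial>lborel) \<le> liminf (\<lambda>n::nat. ?B)"
    by (intro Liminf_mono eventually_sequentiallyI[of "m + 1"])
  also have "\<dots> = ?B" by (simp add: Liminf_const)
  finally show ?thesis using slope_measure.emeasure_open_le_liminf[OF U, of m] by (rule order_trans[rotated])
qed

text \<open>On a bounded interval the energy is integrable, so it is the density of a finite measure
  \<open>\<rho>\<close> that vanishes on the bad slopes. Outer regularity is applied to
  \<open>\<rho>\<close> itself: open sets around the bad slopes have small
  \<open>\<rho>\<close>-measure, and \<open>slope_measure_open_le\<close> carries this over. The
  interval is open so that its intersection with such a set is open again.\<close>

lemma bad_slopes_null: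
  assumes fin: "riesz_energy < top"
  shows "emeasure (slope_measure m) {a. L2_energy (sheared a) = top} = 0"
proof -
  have badm [measurable]: "{a. L2_energy (sheared a) = top} \<in> sets borel" by measurable
  have part: "emeasure (slope_measure m) {a\<in>{-R<..<R}. L2_energy (sheared a) = top} = 0" if R: "R \<ge> 1" for R
  proof -
    let ?I = "{-R<..<R}"
    define B where "B = {a\<in>?I. L2_energy (sheared a) = top}"
    have Bm [measurable]: "B \<in> sets borel" unfolding B_def by measurable
    have int: "(\<integral>\<^sup>+a. indicator ?I a * L2_energy (sheared a) \<partial>lborel) < top"
    proof -
      have "(\<integral>\<^sup>+a. indicator ?I a * L2_energy (sheared a) \<partial>lborel) \<le> (\<integral>\<^sup>+a. indicator {-R..R} a * L2_energy (sheared a) \<partial>lborel)"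
        by (intro nn_integral_mono mult_right_mono) (auto simp: indicator_def)
      also have "\<dots> \<le> ennreal (8 * R + 4) * riesz_energy" by (rule integral_L2_energy_le[OF R])
      also have "\<dots> < top" using fin by (simp add: ennreal_mult_less_top)
      finally show ?thesis .
    qed
    define \<rho> where "\<rho> = density lborel (\<lambda>a. indicator ?I a * L2_energy (sheared a))"
    have em: "emeasure \<rho> A = (\<integral>\<^sup>+a. indicator (A \<inter> ?I) a * L2_energy (sheared a) \<partial>lborel)" if "A \<in> sets borel" for A
      unfolding \<rho>_def using that
      by (subst emeasure_density) (auto intro!: nn_integral_cong simp: indicator_def)
    have "AE a in lborel. indicator ?I a * L2_energy (sheared a) \<noteq> top"
      using nn_integral_PInf_AE[of "\<lambda>a. indicator ?I a * L2_energy (sheared a)" lborel] int by simp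
    then have "AE a in lborel. a \<notin> B" by eventually_elim (auto simp: B_def)
    then have "AE a in lborel. indicator (B \<inter> ?I) a * L2_energy (sheared a) = 0" by eventually_elim simp
    then have "emeasure \<rho> B = 0" using em[OF Bm] by (simp add: nn_integral_0_iff_AE)
    moreover have "emeasure \<rho> B = (INF U \<in> {U. B \<subseteq> U \<and> open U}. emeasure \<rho> U)"
    proof (rule outer_regular)
      show "emeasure \<rho> (space \<rho>) \<noteq> \<infinity>" using em[of UNIV] int by (simp add: \<rho>_def)
    qed (simp_all add: \<rho>_def)
    ultimately have INF0: "(INF U \<in> {U. B \<subseteq> U \<and> open U}. emeasure \<rho> U) = 0" by simp
    have le: "emeasure (slope_measure m) B \<le> 2 ^ (m + 2) * emeasure \<rho> U" if "B \<subseteq> U" "open U" for U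
    proof -
      have "emeasure (slope_measure m) B \<le> emeasure (slope_measure m) (U \<inter> ?I)"
        using that by (intro emeasure_mono) (auto simp: B_def)
      also have "\<dots> \<le> 2 ^ (m + 2) * (\<integral>\<^sup>+a. indicator (U \<inter> ?I) a * L2_energy (sheared a) \<partial>lborel)"
        using that by (intro slope_measure_open_le) auto
      finally show ?thesis using em[of U] that by simp
    qed
    have "emeasure (slope_measure m) B / 2 ^ (m + 2) \<le> emeasure \<rho> U" if "B \<subseteq> U" "open U" for U
    proof (rule divide_le_posI_ennreal)
      show "(0 :: ennreal) < 2 ^ (m + 2)" unfolding zero_less_iff_neq_zero by simp
    qed (rule le[OF that])
    then have "emeasure (slope_measure m) B / 2 ^ (m + 2) \<le> (INF U \<in> {U. B \<subseteq> U \<and> open U}. emeasure \<rho> U)"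
      by (intro INF_greatest) auto
    then show ?thesis unfolding INF0 B_def[symmetric]
      by (auto simp: ennreal_mult_eq_top_iff power_eq_top_ennreal)
  qed
  have "{a. L2_energy (sheared a) = top} = (\<Union>R. {a\<in>{-real (Suc R)<..<real (Suc R)}. L2_energy (sheared a) = top})"
  proof safe
    fix a :: real
    assume "L2_energy (sheared a) = top"
    moreover obtain R where "\<bar>a\<bar> < real R" using reals_Archimedean2 by blast
    ultimately show "a \<in> (\<Union>R. {a\<in>{-real (Suc R)<..<real (Suc R)}. L2_energy (sheared a) = top})"
      by (intro UN_I[of R]) auto
  qed
  moreover have "emeasure (slope_measure m) (\<Union>R. {a\<in>{-real (Suc R)<..<real (Suc R)}. L2_energy (sheared a) = top}) = 0"
  proof (rule emeasure_UN_eq_0)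
    show "emeasure (slope_measure m) {a\<in>{-real (Suc R)<..<real (Suc R)}. L2_energy (sheared a) = top} = 0" for R
      by (rule part) simp
    have "{a\<in>{-real (Suc R)<..<real (Suc R)}. L2_energy (sheared a) = top} \<in> sets borel" for R by measurable
    then show "range (\<lambda>R. {a\<in>{-real (Suc R)<..<real (Suc R)}. L2_energy (sheared a) = top}) \<subseteq> sets (slope_measure m)"
      by (auto simp del: of_nat_Suc)
  qed
  ultimately show ?thesis by simp
qed

theorem AE_slope_L2_energy_finite:
  assumes fin: "riesz_energy < top"
  shows "AE x in \<mu>. AE y in \<mu>. x $ 1 \<noteq> y $ 1 \<longrightarrow> L2_energy (sheared (slope x y)) < top"
proof -
  have "AE p in \<mu> \<Otimes>\<^sub>M \<mu>. p \<notin> {(x, y). (x, y) \<in> slab_pairs m \<and> L2_energy (sheared (slope x y)) = top}" for m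
  proof (rule AE_not_in)
    have "{(x, y). (x, y) \<in> slab_pairs m \<and> L2_energy (sheared (slope x y)) = top} \<in> sets (\<mu> \<Otimes>\<^sub>M \<mu>)"
      unfolding slab_pairs_def by (rule measurable_pair_predicate) measurable
    moreover have "emeasure (\<mu> \<Otimes>\<^sub>M \<mu>) {(x, y). (x, y) \<in> slab_pairs m \<and> L2_energy (sheared (slope x y)) = top} = 0"
      using bad_slopes_null[OF fin, of m] by (subst (asm) emeasure_slope_measure) auto
    ultimately show "{(x, y). (x, y) \<in> slab_pairs m \<and> L2_energy (sheared (slope x y)) = top} \<in> null_sets (\<mu> \<Otimes>\<^sub>M \<mu>)"
      by (rule null_setsI[rotated])
  qed
  then have "AE p in \<mu> \<Otimes>\<^sub>M \<mu>. \<forall>m. p \<notin> {(x, y). (x, y) \<in> slab_pairs m \<and> L2_energy (sheared (slope x y)) = top}"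
    by (simp add: AE_all_countable)
  then have "AE p in \<mu> \<Otimes>\<^sub>M \<mu>. fst p $ 1 \<noteq> snd p $ 1 \<longrightarrow> L2_energy (sheared (slope (fst p) (snd p))) < top"
  proof eventually_elim
    case (elim p)
    obtain x y where p: "p = (x, y)" by fastforce
    obtain m where m: "\<bar>x $ 1 - y $ 1\<bar> < 2 ^ m" using real_arch_pow[of 2] by auto
    then show ?case using elim[rule_format, of m] by (auto simp: p slab_pairs_def less_top)
  qed
  from pp.AE_pair[OF this] show ?thesis by simp
qed

end

section \<open>Good pins\<close>

lemma null_set_affine_preimage:
  fixes a b :: real
  assumes N: "N \<in> null_sets lborel" and a: "a \<noteq> 0"
  shows "{t. b + a * t \<in> N} \<in> null_sets lborel"
proof -
  have [measurable]: "N \<in> sets borel" using N by (simp add: null_sets_def)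
  have m: "{t. b + a * t \<in> N} \<in> sets borel" by measurable
  have "emeasure lborel N = (\<integral>\<^sup>+t. indicator N t \<partial>lborel)" by simp
  also have "\<dots> = ennreal \<bar>a\<bar> * (\<integral>\<^sup>+t. indicator N (b + a * t) \<partial>lborel)"
    by (rule nn_integral_real_affine) (use a in auto)
  also have "(\<integral>\<^sup>+t. indicator N (b + a * t) \<partial>lborel) = (\<integral>\<^sup>+t. indicator {t. b + a * t \<in> N} t \<partial>lborel)"
    by (simp add: indicator_def)
  also have "\<dots> = emeasure lborel {t. b + a * t \<in> N}" using m by simp
  finally have "ennreal \<bar>a\<bar> * emeasure lborel {t. b + a * t \<in> N} = 0" using N by (simp add: null_sets_def)
  then show ?thesis using a m by (auto simp: null_sets_def)
qed

lemma triangle_area_eq: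
  "triangle_area x y z = \<bar>(z $ 1 - x $ 1) * (y $ 2 - x $ 2) - (y $ 1 - x $ 1) * (z $ 2 - x $ 2)\<bar> / 2"
proof -
  have "compact (convex hull {x, y, z})" by (simp add: finite_imp_compact_convex_hull)
  then have "convex hull {x, y, z} \<in> sets lborel" by (simp add: borel_compact)
  then have "triangle_area x y z = measure lborel (convex hull {x, y, z})"
    unfolding triangle_area_def by (simp add: measure_completion)
  also have "\<dots> = \<bar>(z $ 1 - x $ 1) * (y $ 2 - x $ 2) - (y $ 1 - x $ 1) * (z $ 2 - x $ 2)\<bar> / 2"
    by (rule content_triangle)
  finally show ?thesis .
qed

text \<open>For \<open>a = slope x y\<close> the difference \<open>shear a z - shear a x\<close> is
  the vertical offset of \<open>z\<close> from the line through \<open>x\<close> and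
  \<open>y\<close>; the area is half its absolute value times the horizontal extent of the side from
  \<open>x\<close> to \<open>y\<close>.\<close>

lemma triangle_area_shear:
  assumes "x $ 1 \<noteq> y $ 1"
  shows "triangle_area x y z = \<bar>x $ 1 - y $ 1\<bar> / 2 * \<bar>shear (slope x y) z - shear (slope x y) x\<bar>"
proof -
  have "(z $ 1 - x $ 1) * (y $ 2 - x $ 2) - (y $ 1 - x $ 1) * (z $ 2 - x $ 2)
      = (x $ 1 - y $ 1) * (shear (slope x y) z - shear (slope x y) x)"
  proof -
    have eq: "slope x y * (x $ 1 - y $ 1) = x $ 2 - y $ 2" using assms by (simp add: slope_def)
    have "(x $ 1 - y $ 1) * (shear (slope x y) z - shear (slope x y) x)
        = (x $ 1 - y $ 1) * (z $ 2 - x $ 2) - (x $ 2 - y $ 2) * (z $ 1 - x $ 1)"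
      unfolding eq[symmetric] by (simp add: shear_def algebra_simps)
    then show ?thesis by (simp only:) (simp add: algebra_simps)
  qed
  then show ?thesis unfolding triangle_area_eq by (simp add: abs_mult)
qed

section \<open>Consequences of the Frostman condition with exponent above 1\<close>

locale frostman_measure = planar_measure +
  fixes s C :: real
  assumes s: "s > 1" and C: "C \<ge> 0"
    and emeasure_cball_le: "r > 0 \<Longrightarrow> emeasure \<mu> (cball x r) \<le> ennreal (C * r powr s)"
begin

text \<open>A segment of length \<open>2 * K\<close> is covered by \<open>2 * K * N + 1\<close>
  balls of radius \<open>1 / N\<close>, of total mass at most a constant times
  \<open>N powr (1 - s)\<close>, which tends to 0.\<close>

lemma vertical_line_null: "{y. y $ 1 = c} \<in> null_sets \<mu>"
proof -
  have "emeasure \<mu> {y. y $ 1 = c \<and> \<bar>y $ 2\<bar> \<le> real K} = 0" for K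
  proof -
    let ?V = "{y :: real^2. y $ 1 = c \<and> \<bar>y $ 2\<bar> \<le> real K}"
    let ?b = "\<lambda>N. C * (2 * K + 1) * real N powr (1 - s)"
    have le: "emeasure \<mu> ?V \<le> ennreal (?b N)" if "N \<ge> 1" for N
    proof -
      define r where "r = 1 / real N"
      have r: "r > 0" using that by (simp add: r_def)
      have "?V \<subseteq> (\<Union>j\<in>{0..2 * K * N}. cball (vector [c, j * r - K]) r)"
      proof
        fix y assume y: "y \<in> ?V"
        define j where "j = nat \<lfloor>(y $ 2 + K) * N\<rfloor>"
        have 0: "0 \<le> (y $ 2 + K) * N" using y by auto
        have "(y $ 2 + K) * N \<le> (2 * real K) * real N" using y by (intro mult_right_mono) auto
        then have "\<lfloor>(y $ 2 + K) * N\<rfloor> \<le> \<lfloor>real_of_int (int (2 * K * N))\<rfloor>" by (intro floor_mono) simp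
        then have "\<lfloor>(y $ 2 + K) * N\<rfloor> \<le> int (2 * K * N)" unfolding floor_of_int .
        then have j: "j \<in> {0..2 * K * N}" unfolding j_def by (simp add: nat_le_iff)
        have jr: "real j = of_int \<lfloor>(y $ 2 + K) * N\<rfloor>" using 0 by (simp add: j_def)
        have "\<bar>(y $ 2 + K) * N - j\<bar> \<le> 1" unfolding jr by linarith
        then have "\<bar>(y $ 2 + K) * N - j\<bar> * r \<le> 1 * r" using r by (intro mult_right_mono) auto
        moreover have "\<bar>(y $ 2 + K) * N - j\<bar> * r = \<bar>((y $ 2 + K) * N - j) * r\<bar>" using r by (simp add: abs_mult)
        moreover have "((y $ 2 + K) * N - j) * r = y $ 2 - (j * r - K)" using that by (simp add: r_def field_simps)
        ultimately have "\<bar>y $ 2 - (j * r - K)\<bar> \<le> r" by simp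
        then have "dist (vector [c, j * r - K]) y \<le> r"
          using dist_le_coordinates[of "vector [c, j * r - K]" y] y by (simp add: abs_minus_commute)
        then show "y \<in> (\<Union>j\<in>{0..2 * K * N}. cball (vector [c, j * r - K]) r)" using j by auto
      qed
      then have "emeasure \<mu> ?V \<le> emeasure \<mu> (\<Union>j\<in>{0..2 * K * N}. cball (vector [c, j * r - K]) r)"
        by (intro emeasure_mono) auto
      also have "\<dots> \<le> (\<Sum>j\<in>{0..2 * K * N}. emeasure \<mu> (cball (vector [c, j * r - K]) r))"
        by (rule emeasure_subadditive_finite) auto
      also have "\<dots> \<le> (\<Sum>j\<in>{0..2 * K * N}. ennreal (C * r powr s))"
        by (intro sum_mono emeasure_cball_le r)
      also have "\<dots> = ennreal ((2 * K * N + 1) * (C * r powr s))"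
        using C by (simp add: ennreal_mult' ennreal_of_nat_eq_real_of_nat[symmetric] flip: of_nat_mult)
      also have "\<dots> \<le> ennreal (((2 * K + 1) * N) * (C * r powr s))"
        using that C by (intro ennreal_leI mult_right_mono) (auto simp: algebra_simps)
      also have "((2 * K + 1) * N) * (C * r powr s) = ?b N"
      proof -
        have "real N * r powr s = real N powr (1 - s)" using that by (simp add: r_def powr_divide powr_diff)
        from this[symmetric] show ?thesis by (simp add: algebra_simps)
      qed
      finally show ?thesis .
    qed
    have "(\<lambda>N. real N powr (1 - s)) \<longlonglongrightarrow> 0"
      using s by (intro tendsto_neg_powr filterlim_real_sequentially) auto
    then have "(\<lambda>N. ?b N) \<longlonglongrightarrow> C * (2 * K + 1) * 0" by (intro tendsto_mult tendsto_const)
    then have "(\<lambda>N. ennreal (?b N)) \<longlonglongrightarrow> ennreal 0" by (intro tendsto_ennrealI) simp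
    then have "emeasure \<mu> ?V \<le> ennreal 0"
      by (rule tendsto_lowerbound[OF _ eventually_sequentiallyI[of 1]]) (simp_all only: le trivial_limit_sequentially not_False_eq_True)
    then show ?thesis by simp
  qed
  moreover have V: "{y. y $ 1 = c \<and> \<bar>y $ 2\<bar> \<le> real K} \<in> sets \<mu>" for K
    unfolding sets_borel by measurable
  ultimately have "(\<Union>K. {y. y $ 1 = c \<and> \<bar>y $ 2\<bar> \<le> real K}) \<in> null_sets \<mu>"
    by (intro null_sets_UN null_setsI)
  moreover have "(\<Union>K. {y. y $ 1 = c \<and> \<bar>y $ 2\<bar> \<le> real K}) = {y :: real^2. y $ 1 = c}"
    using real_arch_simple by auto
  ultimately show ?thesis by (simp only:)
qed

lemma finite_null: "finite F \<Longrightarrow> F \<in> null_sets \<mu>"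
proof (induction F rule: finite_induct)
  case (insert x F)
  have "{x} \<in> null_sets \<mu>"
    by (rule null_sets_subset[OF vertical_line_null[of "x $ 1"]]) auto
  then have "{x} \<union> F \<in> null_sets \<mu>" using insert by (intro null_sets.Un)
  then show ?case by simp
qed simp

text \<open>The kernel is dominated by 1 plus a sum over dyadic balls around \<open>x\<close> with
  weights \<open>2 ^ (k + 1)\<close>. The Frostman bound turns the sum into a geometric series of
  ratio \<open>2 powr (1 - s) < 1\<close>, uniformly in \<open>x\<close>.\<close>

lemma riesz_energy_finite: "riesz_energy < top"
proof -
  define q where "q = (2 :: real) powr (1 - s)"
  have q: "0 \<le> q" "q < 1" using s by (auto simp: q_def powr_less_one)
  define J where "J = emeasure \<mu> UNIV + ennreal (\<Sum>k. 2 * C * q ^ k)"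
  have "(\<integral>\<^sup>+y. inverse (ennreal (dist x y)) \<partial>\<mu>) \<le> J" for x
  proof -
    have "(\<integral>\<^sup>+y. inverse (ennreal (dist x y)) \<partial>\<mu>) \<le> (\<integral>\<^sup>+y. 1 + (\<Sum>k. 2 ^ (k + 1) * indicator (cball x (1 / 2 ^ k)) y) \<partial>\<mu>)"
    proof (rule nn_integral_mono_AE)
      have "AE y in \<mu>. y \<notin> {x}" by (intro AE_not_in finite_null) simp
      then show "AE y in \<mu>. inverse (ennreal (dist x y)) \<le> 1 + (\<Sum>k. 2 ^ (k + 1) * indicator (cball x (1 / 2 ^ k)) y)"
      proof eventually_elim
        case (elim y)
        then have d: "dist x y > 0" by simp
        have inv: "inverse (ennreal (dist x y)) = ennreal (1 / dist x y)"
          using d by (simp add: inverse_ennreal inverse_eq_divide)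
        show ?case
        proof (cases "dist x y \<le> 1")
          case True
          obtain n where n: "dist x y \<le> 1 / 2 ^ n" "1 / 2 ^ n \<le> 2 * dist x y" using dyadic_scale[OF d True] by blast
          have "1 / dist x y \<le> 2 ^ (n + 1)" using n d by (simp add: field_simps)
          then have "inverse (ennreal (dist x y)) \<le> ennreal (2 ^ (n + 1))" unfolding inv by (rule ennreal_leI)
          also have "\<dots> = 2 ^ (n + 1) * indicator (cball x (1 / 2 ^ n)) y"
            using n(1) by (simp add: ennreal_mult flip: ennreal_power)
          also have "\<dots> \<le> (\<Sum>k. 2 ^ (k + 1) * indicator (cball x (1 / 2 ^ k)) y)"
          proof -
            have "h n \<le> (\<Sum>k. h k)" for h :: "nat \<Rightarrow> ennreal" using sum_le_suminf[of h "{n}"] by simp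
            then show ?thesis .
          qed
          finally show ?thesis by (simp add: add_increasing)
        next
          case False
          then have "inverse (ennreal (dist x y)) \<le> 1" unfolding inv using d by (simp add: divide_le_eq)
          then show ?thesis by (simp add: add_increasing2)
        qed
      qed
    qed
    also have "\<dots> = emeasure \<mu> UNIV + (\<Sum>k. 2 ^ (k + 1) * emeasure \<mu> (cball x (1 / 2 ^ k)))"
    proof -
      have [measurable]: "cball x \<rho> \<in> sets borel" for \<rho> by simp
      have "(\<integral>\<^sup>+y. 1 + (\<Sum>k. 2 ^ (k + 1) * indicator (cball x (1 / 2 ^ k)) y) \<partial>\<mu>)
          = (\<integral>\<^sup>+y. 1 \<partial>\<mu>) + (\<integral>\<^sup>+y. (\<Sum>k. 2 ^ (k + 1) * indicator (cball x (1 / 2 ^ k)) y) \<partial>\<mu>)"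
        by (rule nn_integral_add) measurable
      also have "(\<integral>\<^sup>+y. (\<Sum>k. 2 ^ (k + 1) * indicator (cball x (1 / 2 ^ k)) y) \<partial>\<mu>)
          = (\<Sum>k. \<integral>\<^sup>+y. 2 ^ (k + 1) * indicator (cball x (1 / 2 ^ k)) y \<partial>\<mu>)"
        by (rule nn_integral_suminf) measurable
      also have "\<dots> = (\<Sum>k. 2 ^ (k + 1) * emeasure \<mu> (cball x (1 / 2 ^ k)))"
        by (intro suminf_cong nn_integral_cmult_indicator) simp
      finally show ?thesis by simp
    qed
    also have "\<dots> \<le> emeasure \<mu> UNIV + (\<Sum>k. ennreal (2 * C * q ^ k))"
    proof (intro add_left_mono suminf_le summableI)
      fix k :: nat
      have "2 ^ (k + 1) * emeasure \<mu> (cball x (1 / 2 ^ k)) \<le> 2 ^ (k + 1) * ennreal (C * (1 / 2 ^ k) powr s)"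
        by (intro mult_left_mono emeasure_cball_le) auto
      also have "\<dots> = ennreal (2 ^ (k + 1) * (C * (1 / 2 ^ k) powr s))"
        using C by (simp add: ennreal_mult flip: ennreal_power)
      also have "2 ^ (k + 1) * (C * (1 / 2 ^ k) powr s) = 2 * C * q ^ k"
      proof -
        have "(2::real) ^ k * (1 / 2 ^ k) powr s = (2 powr k) * (2 powr (-k)) powr s"
          by (simp add: powr_realpow powr_minus divide_inverse)
        also have "\<dots> = 2 powr (k * (1 - s))"
          unfolding powr_powr by (simp flip: powr_add add: algebra_simps)
        also have "\<dots> = q ^ k" unfolding q_def
          by (simp add: powr_powr mult.commute flip: powr_realpow)
        finally show ?thesis by simp
      qed
      finally show "2 ^ (k + 1) * emeasure \<mu> (cball x (1 / 2 ^ k)) \<le> ennreal (2 * C * q ^ k)" .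
    qed
    also have "(\<Sum>k. ennreal (2 * C * q ^ k)) = ennreal (\<Sum>k. 2 * C * q ^ k)"
      using C q by (intro suminf_ennreal2) (auto intro!: summable_mult summable_geometric)
    finally show ?thesis unfolding J_def .
  qed
  then have "riesz_energy \<le> (\<integral>\<^sup>+x. J \<partial>\<mu>)" unfolding riesz_energy_def by (rule nn_integral_mono)
  also have "\<dots> = J * emeasure \<mu> UNIV" by simp
  also have "\<dots> < top" 
  proof -
    have "emeasure \<mu> UNIV < top" by (simp add: less_top[symmetric])
    then show ?thesis unfolding J_def by (simp add: ennreal_mult_less_top)
  qed
  finally show ?thesis .
qed

end

text \<open>This is all that the chains need to know about the measure. The point \<open>y\<close>
  is chosen before \<open>F'\<close> and \<open>N\<close>, so \<open>F'\<close> may contain it, and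
  \<open>z\<close> lies in \<open>G\<close> again, so it can be the next pin.\<close>

theorem exists_good_pins:
  fixes E :: "(real^2) set"
  assumes "compact E" "hausdorff_dim E > 1"
  obtains G where "G \<subseteq> E" "G \<noteq> {}"
    "\<And>x F. x \<in> G \<Longrightarrow> finite F \<Longrightarrow>
       \<exists>y\<in>E - F. \<forall>F' N. finite F' \<longrightarrow> N \<in> null_sets lborel \<longrightarrow> (\<exists>z\<in>G - F'. triangle_area x y z \<notin> N)"
proof -
  obtain s where s: "s > 1" "\<And>D. hausdorff_premeasure s D E > 0"
    using hausdorff_dim_gt_imp[of 1 E] assms by auto
  obtain \<mu> :: "(real^2) measure" and C where \<mu>: "sets \<mu> = sets borel" "finite_measure \<mu>"
      "emeasure \<mu> (- E) = 0" "emeasure \<mu> UNIV > 0" "C \<ge> 0"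
      "\<And>x r. r > 0 \<Longrightarrow> emeasure \<mu> (cball x r) \<le> ennreal (C * r powr s)"
    by (rule frostman_plane[OF assms(1) _ s(2)]) (use s(1) in auto)
  interpret frostman_measure \<mu> s C
    by (intro frostman_measure.intro planar_measure.intro planar_measure_axioms.intro frostman_measure_axioms.intro)
      (use \<mu> s in simp_all)
  have nE: "AE x in \<mu>. x \<in> E"
  proof -
    have "- E \<in> null_sets \<mu>" using \<mu>(3) compact_imp_closed[OF assms(1)] by (intro null_setsI) (auto intro: borel_closed)
    from AE_not_in[OF this] show ?thesis by simp
  qed
  have ex: "\<exists>x. P x" if "AE x in \<mu>. P x" for P
  proof (rule ccontr)
    assume "\<not> (\<exists>x. P x)"
    then have "AE x in \<mu>. False" using that by simp
    then have "emeasure \<mu> (space \<mu>) = 0" using ae_filter_eq_bot_iff[of \<mu>] by (simp add: trivial_limit_def)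
    then show False using \<mu>(4) by simp
  qed
  define G where "G = {x\<in>E. AE y in \<mu>. x $ 1 \<noteq> y $ 1 \<longrightarrow> L2_energy (sheared (slope x y)) < top}"
  have AEG: "AE x in \<mu>. x \<in> G"
    using AE_slope_L2_energy_finite[OF riesz_energy_finite] nE by eventually_elim (simp add: G_def)
  show ?thesis
  proof (rule that[of G])
    show "G \<noteq> {}" using ex[OF AEG] by auto
    show "G \<subseteq> E" by (auto simp: G_def)
    fix x and F :: "(real^2) set" assume x: "x \<in> G" and F: "finite F"
    have "AE y in \<mu>. x $ 1 \<noteq> y $ 1 \<longrightarrow> L2_energy (sheared (slope x y)) < top" using x by (simp add: G_def)
    moreover have "AE y in \<mu>. y \<notin> {y. y $ 1 = x $ 1}" by (intro AE_not_in vertical_line_null)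
    moreover have "AE y in \<mu>. y \<notin> F" by (intro AE_not_in finite_null F)
    ultimately have "AE y in \<mu>. y \<in> E - F \<and> x $ 1 \<noteq> y $ 1 \<and> L2_energy (sheared (slope x y)) < top"
      using nE by eventually_elim auto
    from ex[OF this] obtain y where y: "y \<in> E - F" "x $ 1 \<noteq> y $ 1" "L2_energy (sheared (slope x y)) < top" by auto
    show "\<exists>y\<in>E - F. \<forall>F' N. finite F' \<longrightarrow> N \<in> null_sets lborel \<longrightarrow> (\<exists>z\<in>G - F'. triangle_area x y z \<notin> N)"
    proof (intro bexI[OF _ y(1)] allI impI)
      fix F' :: "(real^2) set" and N :: "real set"
      assume F': "finite F'" and N: "N \<in> null_sets lborel"
      define a where "a = slope x y"
      define \<kappa> where "\<kappa> = \<bar>x $ 1 - y $ 1\<bar> / 2"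
      have \<kappa>: "\<kappa> \<noteq> 0" using y by (simp add: \<kappa>_def)
      \<comment> \<open>The absolute value in the area formula has two affine branches;
        \<open>N\<close> is pulled back along both.\<close>
      define N' where "N' = {t. - \<kappa> * shear a x + \<kappa> * t \<in> N} \<union> {t. \<kappa> * shear a x + (- \<kappa>) * t \<in> N}"
      have N': "N' \<in> null_sets lborel" unfolding N'_def
        by (intro null_sets.Un null_set_affine_preimage N) (use \<kappa> in auto)
      have N'b: "N' \<in> sets borel" using N' by (simp add: null_sets_def)
      have "emeasure \<mu> (shear a -` N') = 0"
        using sheared.null_of_L2_energy_finite[of a N'] y(3) N' emeasure_sheared[OF N'b] by (simp add: a_def)
      then have "shear a -` N' \<in> null_sets \<mu>"
        using measurable_sets[OF shear_borel N'b, of a] by (intro null_setsI) auto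
      then have "AE z in \<mu>. z \<notin> shear a -` N'" by (rule AE_not_in)
      moreover have "AE z in \<mu>. z \<notin> F'" by (intro AE_not_in finite_null F')
      ultimately have "AE z in \<mu>. z \<in> G - F' \<and> shear a z \<notin> N'" using AEG by eventually_elim auto
      from ex[OF this] obtain z where z: "z \<in> G - F'" "shear a z \<notin> N'" by auto
      have "triangle_area x y z = \<kappa> * \<bar>shear a z - shear a x\<bar>"
        using triangle_area_shear[OF y(2), of z] by (simp add: \<kappa>_def a_def)
      then have "triangle_area x y z = - \<kappa> * shear a x + \<kappa> * shear a z \<or> triangle_area x y z = \<kappa> * shear a x + (- \<kappa>) * shear a z"
        by (simp add: abs_if algebra_simps)
      then have "triangle_area x y z \<notin> N" using z(2) unfolding N'_def by auto
      then show "\<exists>z\<in>G - F'. triangle_area x y z \<notin> N" using z(1) by blast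
    qed
  qed
qed

section \<open>Chains of triangles\<close>

lemma open_eq_UN_closed:
  fixes S :: "'a::metric_space set"
  assumes "open S"
  shows "\<exists>C :: nat \<Rightarrow> 'a set. (\<forall>n. closed (C n)) \<and> S = (\<Union>n. C n)"
proof (cases "S = UNIV")
  case True
  then show ?thesis by (intro exI[of _ "\<lambda>_. UNIV"]) simp
next
  case False
  define C where "C = (\<lambda>n::nat. {x. infdist x (- S) \<ge> 1 / real (Suc n)})"
  have "closed (C n)" for n unfolding C_def
    by (intro closed_Collect_le continuous_intros)
  moreover have "S = (\<Union>n. C n)"
  proof (intro equalityI subsetI)
    fix x assume "x \<in> S"
    then have "infdist x (- S) \<noteq> 0" using in_closed_iff_infdist_zero[of "- S" x] assms False by auto
    then have "infdist x (- S) > 0" using infdist_nonneg[of x "- S"] by linarith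
    then obtain n where "1 / real (Suc n) < infdist x (- S)"
      using reals_Archimedean[of "infdist x (- S)"] by (auto simp: inverse_eq_divide)
    then show "x \<in> (\<Union>n. C n)" by (auto simp: C_def intro!: exI[of _ n])
  next
    fix x assume "x \<in> (\<Union>n. C n)"
    then obtain n where "infdist x (- S) \<ge> 1 / real (Suc n)" by (auto simp: C_def)
    moreover have "1 / real (Suc n) > 0" by simp
    ultimately have "infdist x (- S) > 0" by linarith
    then show "x \<in> S" by (metis ComplI infdist_zero order_less_irrefl)
  qed
  ultimately show ?thesis by blast
qed

text \<open>Compact images are Borel in the product over all indices, whereas the measure lives on
  the indices in \<open>I\<close>. The inclusion is measurable because every coordinate outside
  \<open>I\<close> is constantly \<open>undefined\<close>.\<close>

lemma borel_extensional_in_sets_PiM: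
  fixes A :: "('i::countable \<Rightarrow> real) set"
  assumes A: "A \<in> sets borel" "A \<subseteq> extensional I"
  shows "A \<in> sets (\<Pi>\<^sub>M i\<in>I. lborel)"
proof -
  let ?P = "\<Pi>\<^sub>M i\<in>I. (borel :: real measure)"
  have sp: "space ?P = extensional I" by (simp add: space_PiM PiE_UNIV_domain extensional_def PiE_def)
  have "(\<lambda>f. f) \<in> measurable ?P (\<Pi>\<^sub>M i\<in>UNIV. (borel :: real measure))"
  proof (rule measurable_PiM_single')
    fix i :: 'i
    show "(\<lambda>f. f i) \<in> measurable ?P borel"
    proof (cases "i \<in> I")
      case True
      then show ?thesis by (rule measurable_component_singleton)
    next
      case False
      have "(\<lambda>f. undefined) \<in> measurable ?P (borel :: real measure)" by simp
      then show ?thesis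
        by (rule measurable_cong[THEN iffD1, rotated]) (use False in \<open>auto simp: sp extensional_def\<close>)
    qed
  qed auto
  moreover have "A \<in> sets (\<Pi>\<^sub>M i\<in>UNIV. (borel :: real measure))" using A(1) by (simp add: sets_PiM_equal_borel)
  ultimately have "(\<lambda>f. f) -` A \<inter> space ?P \<in> sets ?P" by (rule measurable_sets)
  also have "(\<lambda>f. f) -` A \<inter> space ?P = A" using A(2) sp by auto
  also have "sets ?P = sets (\<Pi>\<^sub>M i\<in>I. lborel)" by (rule sets_PiM_cong) simp_all
  finally show ?thesis .
qed

text \<open>
  The triangles with index above \<open>j\<close> of a chain, pinned at \<open>x\<^bsub>2j+1\<^esub>\<close> and avoiding the set \<open>F\<close> of
  vertices that are already in use. Keeping the indices of the whole chain spares a reindexing of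
  the product measure.
\<close>

definition chain_tail :: "(real^2) set \<Rightarrow> nat \<Rightarrow> nat \<Rightarrow> (real^2) set \<Rightarrow> real^2 \<Rightarrow> (nat \<Rightarrow> real) set" where
  "chain_tail E k j F x1 =
     {\<lambda>i\<in>{j+1..k}. triangle_area (x (2*i - 1)) (x (2*i)) (x (2*i + 1)) | x :: nat \<Rightarrow> real^2.
        x (2*j + 1) = x1 \<and> (\<forall>l\<in>{2*j+2..2*k+1}. x l \<in> E - F) \<and> inj_on x {2*j+2..2*k+1}}"

lemma area_chain_set_eq: "area_chain_set k E x1 = chain_tail E k 0 {} x1"
  unfolding area_chain_set_def chain_tail_def by (simp add: numeral_2_eq_2)

text \<open>
  Distinctness of the vertices is an open condition, so the set is a countable union of compact
  sets. Without measurability \<^const>\<open>emeasure\<close> would be \<open>0\<close>.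
\<close>

lemma chain_tail_sets:
  assumes E: "compact E" and F: "finite F"
  shows "chain_tail E k j F x1 \<in> sets (\<Pi>\<^sub>M i\<in>{j+1..k}. lborel)"
proof -
  define L where "L = {2*j+2..2*k+1}"
  define \<Phi> where "\<Phi> = (\<lambda>x :: nat \<Rightarrow> real^2. \<lambda>i\<in>{j+1..k}. triangle_area (x (2*i - 1)) (x (2*i)) (x (2*i + 1)))"
  \<comment> \<open>Freezing the coordinates outside \<open>L\<close> at \<open>x1\<close> makes the
    infinite product compact and also sets the pin, since \<open>2*j+1\<close> lies outside
    \<open>L\<close>.\<close>
  define K where "K = (\<Pi>\<^sub>E l\<in>UNIV. if l \<in> L then E else {x1})"
  define S where "S = (\<Inter>l\<in>L. \<Inter>f\<in>F. {x :: nat \<Rightarrow> real^2. x l \<noteq> f}) \<inter> (\<Inter>l\<in>L. \<Inter>m\<in>L - {l}. {x. x l \<noteq> x m})"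
  have K: "compact K"
  proof -
    have "compactin (product_topology (\<lambda>i::nat. euclidean :: (real^2) topology) UNIV) K"
      unfolding K_def compactin_PiE using E by auto
    then show ?thesis by (simp add: euclidean_product_topology)
  qed
  have S: "open S" unfolding S_def L_def using F
    by (intro open_Int open_INT finite_Diff ballI open_Collect_neq continuous_intros continuous_on_product_coordinates) auto
  have cont: "continuous_on A \<Phi>" for A
  proof (rule continuous_on_coordinatewise_then_product)
    fix i
    show "continuous_on A (\<lambda>x. \<Phi> x i)"
    proof (cases "i \<in> {j+1..k}")
      case True
      have c: "continuous_on A (\<lambda>x :: nat \<Rightarrow> real^2. x l)" for l
        by (rule continuous_on_subset[OF continuous_on_product_coordinates]) simp
      have "continuous_on A (\<lambda>x. triangle_area (x (2*i - 1)) (x (2*i)) (x (2*i + 1)))"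
        unfolding triangle_area_eq by (intro continuous_intros c) auto
      then show ?thesis using True by (simp add: \<Phi>_def)
    next
      case False
      then have "\<Phi> x i = undefined" for x by (auto simp: \<Phi>_def restrict_def)
      then show ?thesis by (simp only: continuous_on_const)
    qed
  qed
  have eq: "chain_tail E k j F x1 = \<Phi> ` (K \<inter> S)"
  proof (intro equalityI subsetI)
    fix c assume "c \<in> chain_tail E k j F x1"
    then obtain x where x: "c = \<Phi> x" "x (2*j + 1) = x1" "\<forall>l\<in>L. x l \<in> E - F" "inj_on x L"
      unfolding chain_tail_def \<Phi>_def L_def by blast
    define x' where "x' = (\<lambda>l. if l \<in> L then x l else x1)"
    have x': "x' l = x l" if "l \<in> {2*j+1..2*k+1}" for l
      using that x(2) by (cases "l = 2*j+1") (auto simp: x'_def L_def)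
    have "\<Phi> x = \<Phi> x'" unfolding \<Phi>_def
    proof (rule restrict_ext)
      fix i assume "i \<in> {j+1..k}"
      then have "2*i - 1 \<in> {2*j+1..2*k+1}" "2*i \<in> {2*j+1..2*k+1}" "2*i + 1 \<in> {2*j+1..2*k+1}" by auto
      then show "triangle_area (x (2*i - 1)) (x (2*i)) (x (2*i + 1)) = triangle_area (x' (2*i - 1)) (x' (2*i)) (x' (2*i + 1))"
        using x' by (simp only:)
    qed
    moreover have "x' \<in> K" using x(3) by (auto simp: K_def x'_def)
    moreover have "x' \<in> S" using x(3,4) by (auto simp: S_def x'_def inj_on_def)
    ultimately show "c \<in> \<Phi> ` (K \<inter> S)" using x(1) by auto
  next
    fix c assume "c \<in> \<Phi> ` (K \<inter> S)"
    then obtain x where x: "c = \<Phi> x" "x \<in> K" "x \<in> S" by auto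
    have xK: "x l \<in> (if l \<in> L then E else {x1})" for l
      using x(2) unfolding K_def by (rule PiE_mem) simp
    have "x (2*j+1) = x1" using xK[of "2*j+1"] by (simp add: L_def)
    moreover have "x l \<in> E" if "l \<in> L" for l using xK[of l] that by simp
    moreover have "\<forall>l\<in>L. x l \<notin> F" "inj_on x L" using x(3) by (auto simp: S_def inj_on_def)
    ultimately show "c \<in> chain_tail E k j F x1"
      unfolding chain_tail_def using x(1) by (auto simp: \<Phi>_def L_def)
  qed
  obtain C where C: "(\<forall>n::nat. closed (C n)) \<and> S = (\<Union>n. C n)" using open_eq_UN_closed[OF S] ..
  then have closed_C: "closed (C n)" and S_eq: "S = (\<Union>n. C n)" for n by blast+
  have "\<Phi> ` (K \<inter> S) = (\<Union>n::nat. \<Phi> ` (K \<inter> C n))" unfolding S_eq by auto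
  moreover have "\<Phi> ` (K \<inter> C n) \<in> sets borel" for n
    by (intro borel_compact compact_continuous_image cont compact_Int_closed K closed_C)
  ultimately have "chain_tail E k j F x1 \<in> sets borel" unfolding eq by (simp add: sets.countable_UN)
  then show ?thesis
    by (rule borel_extensional_in_sets_PiM) (auto simp: chain_tail_def)
qed

text \<open>The pin of a tail is exempt from its own distinctness condition. Hence \<open>z\<close>,
  which becomes an ordinary vertex of the longer chain, must join \<open>y\<close> in the forbidden
  set of the tail.\<close>

lemma chain_tail_extend:
  assumes c: "c \<in> chain_tail E k (Suc j) (insert y (insert z F)) z"
    and y: "y \<in> E - F" and z: "z \<in> E - F" and yz: "y \<noteq> z" and jk: "j < k"
  shows "c(Suc j := triangle_area x1 y z) \<in> chain_tail E k j F x1"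
proof -
  obtain x where x: "c = (\<lambda>i\<in>{j+2..k}. triangle_area (x (2*i - 1)) (x (2*i)) (x (2*i + 1)))"
    "x (2*j+3) = z" "\<forall>l\<in>{2*j+4..2*k+1}. x l \<in> E - insert y (insert z F)" "inj_on x {2*j+4..2*k+1}"
    using c unfolding chain_tail_def by (auto simp: numeral_eq_Suc)
  define x' where "x' = x(2*j+1 := x1, 2*j+2 := y)"
  have x': "x' (2*j+1) = x1" "x' (2*j+2) = y" "x' (2*j+3) = z" "\<And>l. l \<ge> 2*j+3 \<Longrightarrow> x' l = x l"
    using x(2) by (auto simp: x'_def)
  have split: "{2*j+2..2*k+1} = insert (2*j+2) (insert (2*j+3) {2*j+4..2*k+1})" using jk by auto
  have tail: "\<forall>l\<in>{2*j+4..2*k+1}. x' l \<in> E - insert y (insert z F)" using x(3) x'(4) by auto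
  have "inj_on x' {2*j+4..2*k+1}" using x(4) x'(4) by (auto simp: inj_on_def)
  then have "inj_on x' {2*j+2..2*k+1}" unfolding split using tail yz x'(2,3)
    by (auto simp: inj_on_insert)
  moreover have "\<forall>l\<in>{2*j+2..2*k+1}. x' l \<in> E - F" unfolding split using tail y z x'(2,3) by auto
  moreover have "c(Suc j := triangle_area x1 y z) = (\<lambda>i\<in>{j+1..k}. triangle_area (x' (2*i - 1)) (x' (2*i)) (x' (2*i + 1)))"
  proof
    fix i
    consider "i = Suc j" | "i \<in> {j+2..k}" | "i \<notin> {j+1..k}" by force
    then show "(c(Suc j := triangle_area x1 y z)) i = (\<lambda>i\<in>{j+1..k}. triangle_area (x' (2*i - 1)) (x' (2*i)) (x' (2*i + 1))) i"
    proof cases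
      case 1
      have "2 * Suc j - 1 = 2*j+1" "2 * Suc j = 2*j+2" "2 * Suc j + 1 = 2*j+3" by simp_all
      then show ?thesis using 1 jk x'(1-3) by (simp add: numeral_3_eq_3)
    next
      case 2
      then show ?thesis using x(1) x'(4) by auto
    next
      case 3
      then show ?thesis using x(1) jk by auto
    qed
  qed
  ultimately show ?thesis unfolding chain_tail_def using x'(1) by blast
qed

text \<open>Downward induction on \<open>j\<close>. If the set were null, its sections in coordinate
  \<open>Suc j\<close> would be null outside a null set \<open>N\<close> of areas. Some good
  \<open>z\<close> gives an area outside \<open>N\<close>, and the section there contains a tail
  pinned at \<open>z\<close>, which is positive by induction.\<close>

lemma chain_tail_positive:
  fixes E G :: "(real^2) set"
  assumes E: "compact E" and GE: "G \<subseteq> E"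
    and pins: "\<And>x F. x \<in> G \<Longrightarrow> finite F \<Longrightarrow>
       \<exists>y\<in>E - F. \<forall>F' N. finite F' \<longrightarrow> N \<in> null_sets lborel \<longrightarrow> (\<exists>z\<in>G - F'. triangle_area x y z \<notin> N)"
    and jk: "j \<le> k" and x: "x \<in> G" and F: "finite F"
  shows "emeasure (\<Pi>\<^sub>M i\<in>{j+1..k}. lborel) (chain_tail E k j F x) > 0"
  using jk x F
proof (induction j arbitrary: x F rule: inc_induct)
  case base
  \<comment> \<open>No triangle is left when \<open>j = k\<close>: the product over the empty index
    set is the unit mass at this function.\<close>
  have "(\<lambda>_. undefined) \<in> chain_tail E k k F x"
    unfolding chain_tail_def by (auto intro!: exI[of _ "\<lambda>_. x"])
  then have "{\<lambda>_. undefined} \<subseteq> chain_tail E k k F x" by simp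
  then have "emeasure (\<Pi>\<^sub>M i\<in>{k+1..k}. (lborel :: real measure)) {\<lambda>_. undefined} \<le> emeasure (\<Pi>\<^sub>M i\<in>{k+1..k}. lborel) (chain_tail E k k F x)"
    by (rule emeasure_mono[OF _ chain_tail_sets[OF E base(2)]])
  moreover have "emeasure (\<Pi>\<^sub>M i\<in>{k+1..k}. (lborel :: real measure)) {\<lambda>_. undefined} = 1"
    by (simp add: PiM_empty)
  ultimately show ?case by (metis less_le_trans zero_less_one)
next
  case (step j)
  interpret product_sigma_finite "\<lambda>_::nat. lborel :: real measure"
    by (intro product_sigma_finite.intro sigma_finite_lborel)
  let ?D = "chain_tail E k j F x"
  let ?P = "\<Pi>\<^sub>M i\<in>{Suc j+1..k}. (lborel :: real measure)"
  have ins: "{j+1..k} = insert (Suc j) {Suc j+1..k}" using step.hyps by auto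
  have Dm: "?D \<in> sets (\<Pi>\<^sub>M i\<in>insert (Suc j) {Suc j+1..k}. lborel)"
    using chain_tail_sets[OF E step.prems(2), of k j x] unfolding ins .
  define sec where "sec = (\<lambda>t. \<integral>\<^sup>+c. indicator ?D (c(Suc j := t)) \<partial>?P)"
  have "(\<lambda>(t, c). c(Suc j := t)) \<in> measurable (lborel \<Otimes>\<^sub>M ?P) (\<Pi>\<^sub>M i\<in>insert (Suc j) {Suc j+1..k}. lborel)"
    by measurable
  from measurable_compose[OF this borel_measurable_indicator[OF Dm]]
  have joint: "(\<lambda>(t, c). indicator ?D (c(Suc j := t)) :: ennreal) \<in> borel_measurable (lborel \<Otimes>\<^sub>M ?P)"
    by (simp add: split_beta')
  interpret P: sigma_finite_measure ?P by (rule sigma_finite) simp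
  have secm: "sec \<in> borel_measurable lborel"
    unfolding sec_def using P.borel_measurable_nn_integral[OF joint] by simp
  have em: "emeasure (\<Pi>\<^sub>M i\<in>{j+1..k}. lborel) ?D = (\<integral>\<^sup>+t. sec t \<partial>lborel)"
  proof -
    have "emeasure (\<Pi>\<^sub>M i\<in>{j+1..k}. lborel) ?D = (\<integral>\<^sup>+c. indicator ?D c \<partial>(\<Pi>\<^sub>M i\<in>insert (Suc j) {Suc j+1..k}. lborel))"
      unfolding ins using Dm by simp
    also have "\<dots> = (\<integral>\<^sup>+t. sec t \<partial>lborel)" unfolding sec_def
      by (rule product_nn_integral_insert_rev) (use Dm in auto)
    finally show ?thesis .
  qed
  show ?case
  proof (rule ccontr)
    assume "\<not> emeasure (\<Pi>\<^sub>M i\<in>{j+1..k}. lborel) ?D > 0"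
    then have "AE t in lborel. sec t = 0" using em secm by (simp add: nn_integral_0_iff_AE)
    then obtain N where N: "N \<in> null_sets lborel" "\<And>t. t \<notin> N \<Longrightarrow> sec t = 0"
      by (auto elim!: AE_E3)
    obtain y where y: "y \<in> E - F" "\<And>F' N. finite F' \<Longrightarrow> N \<in> null_sets lborel \<Longrightarrow> \<exists>z\<in>G - F'. triangle_area x y z \<notin> N"
      using pins[OF step.prems(1,2)] by blast
    obtain z where z: "z \<in> G - insert y F" "triangle_area x y z \<notin> N"
      using y(2)[of "insert y F" N] step.prems(2) N(1) by blast
    let ?D' = "chain_tail E k (Suc j) (insert y (insert z F)) z"
    have D'm: "?D' \<in> sets ?P" by (rule chain_tail_sets[OF E]) (use step.prems in simp)
    have "c(Suc j := triangle_area x y z) \<in> ?D" if "c \<in> ?D'" for c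
      by (rule chain_tail_extend[OF that]) (use y(1) z(1) GE step.hyps in auto)
    then have "(\<integral>\<^sup>+c. indicator ?D' c \<partial>?P) \<le> sec (triangle_area x y z)"
      unfolding sec_def by (intro nn_integral_mono) (auto simp: indicator_def)
    then have "emeasure ?P ?D' \<le> 0" using D'm N(2)[OF z(2)] by simp
    moreover have "emeasure ?P ?D' > 0"
      by (rule step.IH) (use z(1) step.prems in auto)
    ultimately show False by simp
  qed
qed

theorem theorem1p7:
  fixes k :: nat and E :: "(real^2) set"
  assumes "k \<ge> 1" and "compact E" and "hausdorff_dim E > 1"
  shows "\<exists>x1\<in>E. emeasure (lebesgue_pow k) (area_chain_set k E x1) > 0"
proof -
  show ?thesis
  proof (rule exists_good_pins[OF assms(2,3)])
    fix G
    assume G: "G \<subseteq> E" "G \<noteq> {}"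
      "\<And>x F. x \<in> G \<Longrightarrow> finite F \<Longrightarrow>
         \<exists>y\<in>E - F. \<forall>F' N. finite F' \<longrightarrow> N \<in> null_sets lborel \<longrightarrow> (\<exists>z\<in>G - F'. triangle_area x y z \<notin> N)"
    obtain x1 where x1: "x1 \<in> G" using G(2) by blast
    have "emeasure (\<Pi>\<^sub>M i\<in>{0+1..k}. lborel) (chain_tail E k 0 {} x1) > 0"
      by (rule chain_tail_positive[OF assms(2) G(1) G(3)]) (use x1 in auto)
    moreover have "chain_tail E k 0 {} x1 \<in> sets (\<Pi>\<^sub>M i\<in>{0+1..k}. lborel)"
      by (rule chain_tail_sets[OF assms(2)]) simp
    ultimately have "emeasure (lebesgue_pow k) (area_chain_set k E x1) > 0"
      unfolding area_chain_set_eq lebesgue_pow_def by simp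
    then show ?thesis using x1 G(1) by blast
  qed
qed

end
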